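(* Let $P=(p_1,p_2,\ldots)$ be a sequence of prime numbers and $k\in\mathbb{N}$. If $k$ is a multiple of some prime number which occurs infinitely often in $P$, then there is no $k$-fold connected covering of the $P$-adic solenoid $\Sigma_P$. Otherwise, the limit mapping $h^k_P:\Sigma_P\to\Sigma_P$ is a $k$-fold connected covering and, moreover, each $k$-fold connected covering of $\Sigma_P$ is equivalent to $h^k_P$.
   Context: $\mathbb{N}$ is the set of positive integers; $1$ is not a prime. $\mathbb{S}^1$ is the unit circle in $\mathbb{C}$. For a sequence $P=(p_1,p_2,\ldots)$ of prime numbers, the $P$-adic solenoid is the inverse limit $\Sigma_P=\{(z_1,z_2,\ldots)\in\prod_{n\ge 1}\mathbb{S}^1 : z_{n+1}^{p_n}=z_n \text{ for all } n\in\mathbb{N}\}$ with the topology induced from the product topology. For $k\in\mathbb{N}$ the limit mapping $h^k_P:\Sigma_P\to\Sigma_P$ is $h^k_P((z_1,z_2,\ldots))=(z_1^k,z_2^k,\ldots)$. A prime $p$ occurs infinitely often in $P$ if $p=p_n$ for infinitely many indices $n\in\mathbb{N}$. All topological spaces are assumed to be metric, and a mapping between spaces is a continuous function. A surjective mapping $f:X\to Y$ is a $k$-fold covering mapping ($k\in\mathbb{N}$) if every point $y\in Y$ has an open neighborhood $W$ in $Y$ such that $f^{-1}(W)$ is the union of $k$ (pairwise) disjoint open subsets of $X$, each of which is mapped homeomorphically onto $W$ under $f$. A $k$-fold connected covering of $\Sigma_P$ is a $k$-fold covering mapping from a connected space onto $\Sigma_P$. Finite-sheeted covering mappings $f_1:X_1\to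 Y$ and $f_2:X_2\to Y$ are equivalent if there is a homeomorphism $g:X_1\to X_2$ such that $f_1=f_2\circ g$. *)

theory Defs
  imports "HOL-Analysis.Analysis" "HOL-Computational_Algebra.Primes"
begin

text \<open>
  Sequences are indexed from \<open>0\<close>: the primes \<open>p\<^sub>1, p\<^sub>2, \<dots>\<close> are \<open>P 0, P 1, \<dots>\<close>,
  and the coordinates \<open>z\<^sub>1, z\<^sub>2, \<dots>\<close> are \<open>z 0, z 1, \<dots>\<close>.
\<close>

definition solenoid :: "(nat \<Rightarrow> nat) \<Rightarrow> (nat \<Rightarrow> complex) topology" where
  "solenoid P =
     subtopology (product_topology (\<lambda>_. top_of_set (sphere 0 1)) UNIV)
       {z. \<forall>n. z (Suc n) ^ P n = z n}"

definition limit_map :: "nat \<Rightarrow> (nat \<Rightarrow> complex) \<Rightarrow> (nat \<Rightarrow> complex)" where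
  "limit_map k z = (\<lambda>n. z n ^ k)"

definition occurs_infinitely_often :: "nat \<Rightarrow> (nat \<Rightarrow> nat) \<Rightarrow> bool" where
  "occurs_infinitely_often p P \<longleftrightarrow> infinite {n. P n = p}"

text \<open>
  The sheets over \<open>W\<close> form a set \<open>\<V>\<close> rather than an indexed family. As \<open>W\<close> is nonempty,
  so is every sheet; disjoint sheets are therefore distinct and \<open>card \<V>\<close> counts them.
\<close>

definition k_fold_covering_map ::
    "nat \<Rightarrow> 'a topology \<Rightarrow> 'b topology \<Rightarrow> ('a \<Rightarrow> 'b) \<Rightarrow> bool" where
  "k_fold_covering_map k X Y f \<longleftrightarrow>
     continuous_map X Y f \<and>
     f ` topspace X = topspace Y \<and>
     (\<forall>y\<in>topspace Y. \<exists>W. openin Y W \<and> y \<in> W \<and>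
        (\<exists>\<V>. finite \<V> \<and> card \<V> = k \<and> pairwise disjnt \<V> \<and>
             \<Union>\<V> = {x \<in> topspace X. f x \<in> W} \<and>
             (\<forall>U\<in>\<V>. openin X U \<and>
                homeomorphic_map (subtopology X U) (subtopology Y W) f)))"

text \<open>All spaces are understood to be metric, hence the metrizability of the total space.\<close>

definition k_fold_connected_covering ::
    "nat \<Rightarrow> 'a topology \<Rightarrow> 'b topology \<Rightarrow> ('a \<Rightarrow> 'b) \<Rightarrow> bool" where
  "k_fold_connected_covering k X Y f \<longleftrightarrow>
     metrizable_space X \<and> connected_space X \<and> k_fold_covering_map k X Y f"

definition equivalent_coverings ::
    "'a topology \<Rightarrow> ('a \<Rightarrow> 'c) \<Rightarrow> 'b topology \<Rightarrow> ('b \<Rightarrow> 'c) \<Rightarrow> bool" where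
  "equivalent_coverings X\<^sub>1 f\<^sub>1 X\<^sub>2 f\<^sub>2 \<longleftrightarrow>
     (\<exists>g. homeomorphic_map X\<^sub>1 X\<^sub>2 g \<and> (\<forall>x\<in>topspace X\<^sub>1. f\<^sub>1 x = f\<^sub>2 (g x)))"

end

theory Submission
  imports Defs "HOL-Combinatorics.Orbits"
begin

text \<open>
  By compactness, the sheets of a \<open>k\<close>-fold covering \<open>f : X \<rightarrow> \<Sigma>\<^sub>P\<close> can be labelled by
  \<open>0, \<dots>, k - 1\<close> over each of finitely many arcs of a single coordinate circle \<open>z m\<close>, with
  constant transitions between neighbouring arcs. So the covering is pulled back, along the
  \<open>m\<close>-th projection, from a covering of the circle, given by a monodromy permutation of the labels.
  As \<open>X\<close> is connected, this permutation is a \<open>k\<close>-cycle, which yields a continuous function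
  \<open>w\<close> on \<open>X\<close> with \<open>w x ^ k = f x m\<close> such that \<open>(f, w)\<close> is a bijection from \<open>X\<close> to
  \<open>{(z, u). u ^ k = z m}\<close>. Here \<open>m\<close> may be chosen arbitrarily large.

  If a prime \<open>p\<close> dividing \<open>k\<close> occurs infinitely often, then \<open>z m\<close> has a continuous \<open>p\<close>-th root
  \<open>v\<close> on \<open>\<Sigma>\<^sub>P\<close>, and \<open>w ^ (k div p) / v\<close> is a nonconstant function from the connected space \<open>X\<close>
  to the \<open>p\<close>-th roots of unity, a contradiction. Otherwise all primes \<open>P n\<close> with \<open>n \<ge> m\<close> are
  coprime to \<open>k\<close> if \<open>m\<close> is large, and \<open>y \<mapsto> (limit_map k y, y m)\<close> is a bijection from
  \<open>\<Sigma>\<^sub>P\<close> to \<open>{(z, u). u ^ k = z m}\<close> as well.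
\<close>

section \<open>The circle\<close>

text \<open>The universal covering of the circle, normalised to period 1, so that lifts of a point
  differ by integers.\<close>

definition circ :: "real \<Rightarrow> complex" where
  "circ t = cis (2 * pi * t)"

lemma circ_in_sphere [simp]: "circ t \<in> sphere 0 1" "norm (circ t) = 1" "circ t \<noteq> 0"
  by (auto simp: circ_def)

lemma circ_add: "circ (s + t) = circ s * circ t"
  by (simp add: circ_def cis_mult ring_distribs)

lemma circ_power: "circ t ^ n = circ (real n * t)"
  unfolding circ_def Complex.DeMoivre by (rule arg_cong [of _ _ cis]) simp

lemma circ_of_int [simp]: "circ (of_int n) = 1"
  unfolding circ_def by (rule cis_multiple_2pi) simp

lemma circ_of_nat [simp]: "circ (of_nat n) = 1"
  using circ_of_int [of "int n"] by simp

lemma circ_add_of_int: "circ (t + of_int n) = circ t"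
  by (simp add: circ_add)

lemma circ_eq_iff: "circ s = circ t \<longleftrightarrow> (\<exists>n::int. s = t + of_int n)"
proof
  assume "circ s = circ t"
  then have "sin (2 * pi * s) = sin (2 * pi * t) \<and> cos (2 * pi * s) = cos (2 * pi * t)"
    by (simp add: circ_def complex_eq_iff)
  then obtain n :: int where "2 * pi * s = 2 * pi * t + 2 * pi * n"
    by (auto simp: sin_cos_eq_iff)
  then have "2 * pi * s = 2 * pi * (t + n)"
    by (simp add: ring_distribs)
  then show "\<exists>n::int. s = t + of_int n"
    by auto
qed (auto simp: circ_add_of_int)

lemma cis_Arg_unit: "norm w = 1 \<Longrightarrow> cis (Arg w) = w"
  using cis_Arg [of w] by (cases "w = 0") (auto simp: sgn_div_norm)

text \<open>Shifting the normalised argument by a full turn makes the lift positive. Later arc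
  indices come from \<open>nat\<close> of a floor, which must not truncate.\<close>

lemma circ_surj:
  assumes "norm w = 1"
  obtains t where "t > 0" "w = circ t"
proof
  have "w = cis (Arg w)"
    using assms by (simp add: cis_Arg_unit)
  also have "\<dots> = circ (Arg w / (2*pi))"
    by (simp add: circ_def)
  finally show "w = circ (Arg w / (2*pi) + of_int 1)"
    by (simp only: circ_add_of_int)
  have "- pi < Arg w"
    by (rule Arg_bounded [THEN conjunct1])
  then have "- (1/2) < Arg w / (2*pi)"
    by (simp add: field_simps)
  then show "0 < Arg w / (2*pi) + of_int 1"
    by simp
qed

lemma dist_circ: "dist (circ s) (circ t) \<le> 2 * pi * \<bar>s - t\<bar>"
proof -
  have "circ s = circ t * circ (s - t)"
    by (simp flip: circ_add)
  then have "circ s - circ t = circ t * (circ (s - t) - 1)"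
    by (simp add: right_diff_distrib)
  then have "dist (circ s) (circ t) = norm (circ (s - t) - 1)"
    by (simp add: dist_norm norm_mult)
  also have "circ (s - t) = exp (\<i> * of_real (2 * pi * (s - t)))"
    by (simp add: circ_def cis_conv_exp)
  also have "norm (\<dots> - 1) \<le> \<bar>2 * pi * (s - t)\<bar>"
    unfolding dist_exp_i_1 using abs_sin_x_le_abs_x [of "2 * pi * (s - t) / 2"] by linarith
  finally show ?thesis
    by (simp add: abs_mult)
qed

text \<open>Continuity of \<open>Arg\<close> at \<open>1\<close>, applied to the quotient of
  \<open>w\<close> and \<open>circ t\<close>, provides a local inverse of
  \<open>circ\<close>.\<close>

lemma circ_local_lift:
  assumes "\<epsilon> > 0"
  obtains \<delta> where "\<delta> > 0"
    "\<And>w. norm w = 1 \<Longrightarrow> dist w (circ t) < \<delta> \<Longrightarrow> \<exists>s. \<bar>s - t\<bar> < \<epsilon> \<and> circ s = w"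
proof -
  have "isCont (\<lambda>w. Arg (w / circ t)) (circ t)"
    by (rule isCont_o2 [OF _ continuous_at_Arg]) auto
  then have "\<exists>\<delta>>0. \<forall>w. dist w (circ t) < \<delta> \<longrightarrow> dist (Arg (w / circ t)) (Arg 1) < 2 * pi * \<epsilon>"
    using assms by (simp add: continuous_at_eps_delta)
  then obtain \<delta> where \<delta>: "\<delta> > 0"
    "\<And>w. dist w (circ t) < \<delta> \<Longrightarrow> \<bar>Arg (w / circ t)\<bar> < 2 * pi * \<epsilon>"
    by (auto simp: dist_norm)
  show thesis
  proof (rule that [OF \<delta>(1)])
    fix w :: complex
    assume w: "norm w = 1" "dist w (circ t) < \<delta>"
    define a where "a = Arg (w / circ t)"
    have "norm (w / circ t) = 1"
      using w by (simp add: norm_divide)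
    then have "w / circ t = cis a"
      unfolding a_def by (simp add: cis_Arg_unit)
    then have "circ (t + a / (2*pi)) = w"
      by (simp add: circ_add nonzero_divide_eq_eq) (simp add: circ_def mult.commute)
    moreover have "\<bar>(t + a / (2*pi)) - t\<bar> < \<epsilon>"
      using \<delta>(2) [OF w(2)] by (simp add: a_def abs_divide field_simps)
    ultimately show "\<exists>s. \<bar>s - t\<bar> < \<epsilon> \<and> circ s = w"
      by blast
  qed
qed

text \<open>The numerator is \<open>t - i\<close>, not \<open>t + i\<close>: one turn of
  \<open>t\<close> is then offset by one step of \<open>i\<close>, which is what
  \<open>root_step\<close> exploits.\<close>

lemma circ_roots:
  assumes "k \<ge> 1" "u ^ k = circ t"
  obtains i where "i < k" "u = circ ((t - real i) / real k)"
proof -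
  have "norm u ^ k = 1"
    using assms(2) by (simp flip: norm_power)
  then have "norm u = 1"
    using assms(1) power_eq_1_iff [of "norm u" k] by simp
  then obtain s where s: "u = circ s"
    by (rule circ_surj)
  then obtain n :: int where n: "real k * s = t + n"
    using assms(2) by (auto simp: circ_power circ_eq_iff)
  \<comment> \<open>From \<open>k * s = t + n\<close> only the class of \<open>- n\<close> modulo
    \<open>k\<close> matters, since multiples of \<open>k\<close> change \<open>s\<close> by
    integers.\<close>
  define i where "i = nat ((- n) mod int k)"
  have i: "int i = (- n) mod int k"
    using assms(1) by (simp add: i_def)
  have "- n = int k * ((- n) div int k) + int i"
    unfolding i by simp
  then have "of_int (- n) = (of_int (int k * ((- n) div int k) + int i) :: real)"
    by (rule arg_cong)
  then have "real_of_int n = - real k * of_int ((- n) div int k) - real i"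
    by simp
  with n have "real k * s = t - real i - real k * of_int ((- n) div int k)"
    by simp
  then have "s = (t - real i) / real k + of_int (- ((- n) div int k))"
    using assms(1) by (simp add: field_simps)
  then have "u = circ ((t - real i) / real k)"
    unfolding s by (simp only: circ_add_of_int)
  moreover have "int i < int k"
    unfolding i using assms(1) by simp
  ultimately show thesis
    using that by auto
qed

lemma circ_roots_distinct:
  assumes "i < k" "j < k" "circ ((t - real i) / real k) = circ ((t - real j) / real k)"
  shows "i = j"
proof -
  obtain n :: int where "(t - real i) / real k = (t - real j) / real k + n"
    using assms(3) by (auto simp: circ_eq_iff)
  then have "t - real i = t - real j + real k * n"
    using assms(1) by (simp add: field_simps)
  then have "real_of_int (int j) = of_int (int i + int k * n)"
    by simp
  then have "int j = int i + int k * n"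
    by (simp only: of_int_eq_iff)
  then have "int j mod int k = int i mod int k"
    by simp
  then show ?thesis
    using assms by simp
qed

section \<open>Topology of solenoids\<close>

lemma continuous_map_compose_on_UNIV:
  assumes "continuous_map X euclidean f" "continuous_on UNIV g"
  shows "continuous_map X euclidean (\<lambda>x. g (f x))"
  using continuous_map_compose [OF assms(1), of euclidean g] assms(2) by (simp add: o_def)

text \<open>Bezout: the quotient \<open>u / v\<close> has trivial \<open>a\<close>-th and
  \<open>b\<close>-th powers, hence is trivial itself.\<close>

lemma power_eq_cancel_coprime:
  fixes u v :: complex
  assumes "coprime a b" "u ^ a = v ^ a" "u ^ b = v ^ b" "v \<noteq> 0"
  shows "u = v"
proof (cases "a = 0")
  case True
  then show ?thesis using assms by simp
next
  case False
  then obtain x y where "a * x = b * y + 1"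
    using bezout_nat [of a b] assms(1) by auto
  then have "(u / v) ^ (a * x) = (u / v) ^ (b * y + 1)"
    by simp
  moreover have "(u / v) ^ a = 1" "(u / v) ^ b = 1"
    using assms by (auto simp: power_divide)
  ultimately have "u / v = 1"
    by (simp add: power_add power_mult)
  then show ?thesis
    using assms by simp
qed

locale solenoid_primes =
  fixes P :: "nat \<Rightarrow> nat"
  assumes prime_P: "prime (P n)"
begin

abbreviation S :: "(nat \<Rightarrow> complex) set" where
  "S \<equiv> topspace (solenoid P)"

text \<open>The degree of the bonding map from coordinate \<open>n\<close> to coordinate
  \<open>m\<close>; the empty product makes it 1 for \<open>n \<le> m\<close>.\<close>

definition N :: "nat \<Rightarrow> nat \<Rightarrow> nat" where
  "N m n = (\<Prod>i\<in>{m..<n}. P i)"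

lemma N_pos: "N m n > 0"
  using prime_P by (auto simp: N_def prime_gt_0_nat intro!: prod_pos)

lemma N_Suc: "m \<le> n \<Longrightarrow> N m (Suc n) = N m n * P n"
  by (simp add: N_def)

lemma topspace_solenoid: "S = {z. (\<forall>n. norm (z n) = 1) \<and> (\<forall>n. z (Suc n) ^ P n = z n)}"
  by (auto simp: solenoid_def PiE_iff)

lemma norm_S: "z \<in> S \<Longrightarrow> norm (z n) = 1"
  and S_step: "z \<in> S \<Longrightarrow> z (Suc n) ^ P n = z n"
  by (auto simp: topspace_solenoid)

lemma S_nonzero: "z \<in> S \<Longrightarrow> z n \<noteq> 0"
  using norm_S [of z n] by auto

lemma S_power: "m \<le> n \<Longrightarrow> z \<in> S \<Longrightarrow> z n ^ N m n = z m"
proof (induction n rule: dec_induct)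
  case base
  then show ?case by (simp add: N_def)
next
  case (step n)
  then have "z (Suc n) ^ N m (Suc n) = (z (Suc n) ^ P n) ^ N m n"
    by (simp add: N_Suc flip: power_mult) (simp add: mult.commute)
  with step show ?case
    by (simp add: S_step)
qed

lemma continuous_map_coord: "continuous_map (solenoid P) euclidean (\<lambda>z. z n)"
proof -
  have "continuous_map (solenoid P) (top_of_set (sphere 0 1)) (\<lambda>z. z n)"
    unfolding solenoid_def
    by (intro continuous_map_from_subtopology continuous_map_product_projection) simp
  then show ?thesis
    by (rule continuous_map_into_fulltopology)
qed

lemma openin_coord: "open V \<Longrightarrow> openin (solenoid P) {z \<in> S. z n \<in> V}"
  using continuous_map_coord [of n] by (auto simp: continuous_map_def)

lemma continuous_map_solenoid:
  "continuous_map X (solenoid P) f \<longleftrightarrow>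
     f \<in> topspace X \<rightarrow> S \<and> (\<forall>n. continuous_map X euclidean (\<lambda>x. f x n))"
  by (auto simp: solenoid_def continuous_map_in_subtopology continuous_map_componentwise_UNIV
      Pi_iff PiE_iff image_subset_iff)

text \<open>A basic open set of the product restricts only finitely many coordinates, and each of
  these is a power of \<open>z n\<close> once \<open>n\<close> bounds their indices. Hence
  conditions on one coordinate already form a basis.\<close>

lemma solenoid_basis:
  assumes U: "openin (solenoid P) U" and y: "y \<in> U"
  obtains n V where "open V" "y n \<in> V" "{z \<in> S. z n \<in> V} \<subseteq> U"
proof -
  let ?C = "\<lambda>_::nat. top_of_set (sphere (0::complex) 1)"
  obtain T where T: "openin (product_topology ?C UNIV) T"
    and UT: "U = T \<inter> {z. \<forall>n. z (Suc n) ^ P n = z n}"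
    using U by (auto simp: solenoid_def openin_subtopology)
  have yS: "y \<in> S"
    using U y openin_subset by blast
  have "y \<in> T"
    using y UT by blast
  with T obtain Q where Q: "finite {i. Q i \<noteq> sphere 0 1}" "\<And>i. openin (?C i) (Q i)"
    "y \<in> Pi\<^sub>E UNIV Q" "Pi\<^sub>E UNIV Q \<subseteq> T"
    unfolding openin_product_topology_alt by fastforce
  have "\<forall>i. \<exists>R. open R \<and> Q i = R \<inter> sphere 0 1"
    using Q(2) by (fastforce simp: openin_open)
  then obtain R where R: "\<And>i. open (R i)" "\<And>i. Q i = R i \<inter> sphere 0 1"
    by metis
  define I where "I = {i. Q i \<noteq> sphere 0 1}"
  obtain n where n: "\<And>i. i \<in> I \<Longrightarrow> i \<le> n"
    using Q(1) unfolding I_def by (meson finite_nat_set_iff_bounded_le mem_Collect_eq)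
  define V where "V = (\<Inter>i\<in>I. (\<lambda>v. v ^ N i n) -` R i)"
  show thesis
  proof
    show "open V"
      unfolding V_def using Q(1) R(1)
      by (auto simp: I_def intro!: open_INT open_vimage continuous_intros)
    show "y n \<in> V"
      using S_power [OF n yS] Q(3) R(2) by (auto simp: V_def PiE_iff)
    show "{z \<in> S. z n \<in> V} \<subseteq> U"
    proof clarify
      fix z assume z: "z \<in> S" "z n \<in> V"
      have "z i \<in> Q i" for i
      proof (cases "i \<in> I")
        case True
        then have "z i \<in> R i"
          using z S_power [OF n z(1)] by (force simp: V_def)
        then show ?thesis
          using R(2) norm_S z(1) by simp
      next
        case False
        then show ?thesis
          using norm_S z(1) by (auto simp: I_def)
      qed
      then have "z \<in> T"
        using Q(4) by (auto simp: PiE_iff)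
      then show "z \<in> U"
        using z(1) by (auto simp: UT topspace_solenoid)
    qed
  qed
qed

section \<open>Compactness, surjectivity of coordinates and connectedness\<close>

lemma Hausdorff_solenoid: "Hausdorff_space (solenoid P)"
  and metrizable_solenoid: "metrizable_space (solenoid P)"
proof -
  show "metrizable_space (solenoid P)"
    unfolding solenoid_def
    by (intro metrizable_space_subtopology)
      (simp add: metrizable_space_product_topology metrizable_space_subtopology
        metrizable_space_euclidean)
  then show "Hausdorff_space (solenoid P)"
    by (rule metrizable_imp_Hausdorff_space)
qed

lemma compact_solenoid: "compact_space (solenoid P)"
proof -
  let ?X = "product_topology (\<lambda>_::nat. top_of_set (sphere (0::complex) 1)) UNIV"
  have c: "continuous_map ?X euclidean (\<lambda>z. z n)" for n
    by (rule continuous_map_into_fulltopology, rule continuous_map_product_projection) simp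
  have "closedin ?X {z \<in> topspace ?X. z (Suc n) ^ P n = z n}" for n
    by (rule closedin_continuous_maps_eq [of euclidean])
      (auto intro!: continuous_map_compose_on_UNIV [OF c] continuous_intros c)
  then have "closedin ?X (\<Inter>n. {z \<in> topspace ?X. z (Suc n) ^ P n = z n})"
    by (intro closedin_INT) auto
  also have "(\<Inter>n. {z \<in> topspace ?X. z (Suc n) ^ P n = z n}) = topspace ?X \<inter> {z. \<forall>n. z (Suc n) ^ P n = z n}"
    by auto
  finally have cl: "closedin ?X (topspace ?X \<inter> {z. \<forall>n. z (Suc n) ^ P n = z n})" .
  have "compact_space (top_of_set (sphere (0::complex) 1))"
    by (intro compact_space_subtopology) simp
  then have "compact_space ?X"
    by (simp only: compact_space_product_topology) blast
  from closedin_compact_space [OF this cl] show ?thesis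
    unfolding solenoid_def
    by (subst subtopology_restrict [symmetric]) (rule compact_space_subtopology)
qed

lemma S_coord_surj:
  assumes "norm w = 1"
  obtains z where "z \<in> S" "z n = w"
proof -
  obtain t where t: "w = circ t"
    using assms by (rule circ_surj)
  \<comment> \<open>The angle is divided by the successive degrees; the factor \<open>N 0 n\<close>
    makes coordinate \<open>n\<close> equal to \<open>w\<close>.\<close>
  define z where "z i = circ (t * real (N 0 n) / real (N 0 i))" for i
  have "z (Suc i) ^ P i = z i" for i
    using prime_P [of i] N_pos [of 0 i]
    by (simp add: z_def circ_power N_Suc prime_gt_0_nat)
  then have "z \<in> S"
    by (simp add: topspace_solenoid z_def)
  moreover have "z n = w"
    using N_pos [of 0 n] by (simp add: z_def t)
  ultimately show thesis
    using that [of z] by simp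
qed

text \<open>Basic sets with the hereditary property \<open>Q\<close> have a finite subcover. Beyond
  its largest index every coordinate \<open>m\<close> works, because each earlier coordinate
  \<open>z i\<close> is a power of \<open>z m\<close> and the sets pull back to coordinate
  \<open>m\<close>.\<close>

lemma uniform_coord:
  assumes ex: "\<And>y. y \<in> S \<Longrightarrow> \<exists>U. openin (solenoid P) U \<and> y \<in> U \<and> Q U"
    and mono: "\<And>U U'. Q U \<Longrightarrow> U' \<subseteq> U \<Longrightarrow> Q U'"
  obtains n where "\<And>m w. n \<le> m \<Longrightarrow> norm w = 1 \<Longrightarrow> \<exists>V. open V \<and> w \<in> V \<and> Q {z \<in> S. z m \<in> V}"
proof -
  define \<U> where "\<U> = {(n, V). open V \<and> Q {z \<in> S. z n \<in> V}}"
  define B where "B p = {z \<in> S. z (fst p) \<in> (snd p :: complex set)}" for p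
  have "\<exists>p\<in>\<U>. y \<in> B p" if "y \<in> S" for y
  proof -
    from ex [OF that] obtain U where U: "openin (solenoid P) U" "y \<in> U" "Q U"
      by (elim exE conjE)
    obtain n V where V: "open V" "y n \<in> V" "{z \<in> S. z n \<in> V} \<subseteq> U"
      using U(1,2) by (rule solenoid_basis)
    then have "(n, V) \<in> \<U>" "y \<in> B (n, V)"
      using mono [OF U(3)] that by (auto simp: \<U>_def B_def)
    then show ?thesis
      by blast
  qed
  then have "S \<subseteq> \<Union>(B ` \<U>)"
    by blast
  moreover have "\<And>T. T \<in> B ` \<U> \<Longrightarrow> openin (solenoid P) T"
    by (auto simp: \<U>_def B_def openin_coord)
  ultimately have "\<exists>\<F>. finite \<F> \<and> \<F> \<subseteq> B ` \<U> \<and> S \<subseteq> \<Union>\<F>"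
    by (intro compactinD) (use compact_solenoid in \<open>auto simp: compact_space_def\<close>)
  then obtain \<F> where \<F>: "finite \<F>" "\<F> \<subseteq> B ` \<U>" "S \<subseteq> \<Union>\<F>"
    by blast
  obtain \<G> where \<G>: "\<G> \<subseteq> \<U>" "finite \<G>" "\<F> = B ` \<G>"
    using finite_subset_image [OF \<F>(1,2)] by blast
  define n where "n = Max (insert 0 (fst ` \<G>))"
  have n: "fst p \<le> n" if "p \<in> \<G>" for p
    using that \<G>(2) by (simp add: n_def)
  show thesis
  proof
    fix m and w :: complex assume m: "n \<le> m" and w: "norm w = 1"
    obtain z where z: "z \<in> S" "z m = w"
      by (rule S_coord_surj [OF w])
    then obtain i V where iV: "(i, V) \<in> \<G>" "z i \<in> V"
      using \<F>(3) \<G>(3) by (force simp: B_def)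
    have im: "i \<le> m"
      using n [OF iV(1)] m by simp
    let ?V = "(\<lambda>v. v ^ N i m) -` V"
    have V: "open V" "Q {z \<in> S. z i \<in> V}"
      using iV(1) \<G>(1) by (auto simp: \<U>_def)
    have "open ?V"
      by (intro open_vimage V continuous_intros)
    moreover have "w \<in> ?V"
      using S_power [OF im z(1)] z(2) iV(2) by simp
    moreover have "Q {z \<in> S. z m \<in> ?V}"
      by (rule mono [OF V(2)]) (use S_power [OF im] in auto)
    ultimately show "\<exists>V. open V \<and> w \<in> V \<and> Q {z \<in> S. z m \<in> V}"
      by blast
  qed
qed

text \<open>Uniformity in one coordinate turns a separation of the solenoid into one of the circle:
  small neighbourhoods in coordinate \<open>n\<close> have preimages inside \<open>A\<close> or
  inside \<open>B\<close>.\<close>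

lemma connected_solenoid: "connected_space (solenoid P)"
  unfolding connected_space_eq
proof clarify
  fix A B
  assume AB: "openin (solenoid P) A" "openin (solenoid P) B" "A \<union> B = S" "A \<inter> B = {}"
    "A \<noteq> {}" "B \<noteq> {}"
  define Q where "Q U \<longleftrightarrow> U \<subseteq> A \<or> U \<subseteq> B" for U
  obtain n where n: "\<And>m w. n \<le> m \<Longrightarrow> norm w = 1 \<Longrightarrow> \<exists>V. open V \<and> w \<in> V \<and> Q {z \<in> S. z m \<in> V}"
  proof (rule uniform_coord [of Q])
    show "\<exists>U. openin (solenoid P) U \<and> y \<in> U \<and> Q U" if "y \<in> S" for y
      using AB that unfolding Q_def by blast
  qed (auto simp: Q_def)
  define W where "W C = {w \<in> sphere 0 1. \<exists>V. open V \<and> w \<in> V \<and> {z \<in> S. z n \<in> V} \<subseteq> C}" for C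
  have op: "openin (top_of_set (sphere 0 1)) (W C)" for C
    unfolding openin_open
  proof (intro exI conjI)
    show "open (\<Union>{V. open V \<and> {z \<in> S. z n \<in> V} \<subseteq> C})"
      by auto
  qed (auto simp: W_def)
  have "sphere 0 1 \<subseteq> W A \<union> W B"
    using n [OF order_refl] by (fastforce simp: W_def Q_def)
  moreover have "W A \<inter> W B = {}"
  proof (rule ccontr)
    assume "W A \<inter> W B \<noteq> {}"
    then obtain w where w: "w \<in> W A" "w \<in> W B" by blast
    then have "norm w = 1"
      by (simp add: W_def)
    then obtain z where z: "z \<in> S" "z n = w"
      by (rule S_coord_surj)
    have "z \<in> C" if "w \<in> W C" for C
      using that z by (auto simp: W_def)
    then have "z \<in> A" "z \<in> B"
      using w by auto
    then show False
      using AB(4) by blast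
  qed
  moreover have "W C \<noteq> {}" if C: "C \<in> {A, B}" for C
  proof -
    obtain z where z: "z \<in> C"
      using C AB by blast
    then have zS: "z \<in> S"
      using C AB(3) by blast
    obtain V where V: "open V" "z n \<in> V" "Q {z \<in> S. z n \<in> V}"
      using n [OF order_refl] norm_S zS by blast
    then have "{z \<in> S. z n \<in> V} \<subseteq> C"
      using z zS C AB(4) unfolding Q_def by blast
    then show ?thesis
      using V norm_S [OF zS] unfolding W_def by fastforce
  qed
  moreover have "connected (sphere (0::complex) 1)"
    by (rule connected_sphere) simp
  ultimately show False
    using op [of A] op [of B] unfolding connected_openin by (metis insertI1 insert_commute)
qed

end

section \<open>Labelling the sheets of a covering\<close>

text \<open>The index runs through all naturals and not just residues modulo \<open>M\<close>, so
  that walking round the circle repeatedly stays inside one sequence of arcs.\<close>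

definition arc :: "nat \<Rightarrow> nat \<Rightarrow> complex set" where
  "arc M j = circ ` {real j / real M..real (Suc j) / real M}"

lemma arc_mod:
  assumes "M > 0"
  shows "arc M (j mod M) = arc M j"
proof -
  have "real j / real M = real (j mod M) / real M + of_int (int (j div M))"
    using assms by (simp add: field_simps flip: of_nat_mult of_nat_add)
  moreover have "real (Suc j) / real M = real (Suc (j mod M)) / real M + of_int (int (j div M))"
    using calculation by (simp add: add_divide_distrib)
  ultimately have "{real j / real M..real (Suc j) / real M} =
      (\<lambda>t. t + of_int (int (j div M))) ` {real (j mod M) / real M..real (Suc (j mod M)) / real M}"
    by (simp only: image_add_atLeastAtMost')
  then show ?thesis
    unfolding arc_def by (simp only: image_image circ_add_of_int)
qed

lemma circ_Suc_mod:
  assumes "M > 0"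
  shows "circ (real (Suc (j mod M)) / real M) = circ (real (Suc j) / real M)"
proof -
  have "real (Suc j) / real M = real (Suc (j mod M)) / real M + of_int (int (j div M))"
    using assms by (simp add: field_simps flip: of_nat_mult of_nat_add)
  then show ?thesis
    by (simp only: circ_add_of_int)
qed

lemma circ_in_arc: "t \<in> {real j / real M..real (Suc j) / real M} \<Longrightarrow> circ t \<in> arc M j"
  by (simp add: arc_def)

text \<open>Lebesgue number lemma: the diameter of an arc is at most
  \<open>2 * pi / M\<close>.\<close>

lemma fine_arcs:
  assumes "\<And>w. norm w = 1 \<Longrightarrow> \<exists>V\<in>\<V>. w \<in> V" "\<And>V. V \<in> \<V> \<Longrightarrow> open V"
  obtains M where "M > 0" "\<And>j. \<exists>V\<in>\<V>. arc M j \<subseteq> V"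
proof -
  have "sphere 0 1 \<subseteq> \<Union>\<V>"
    using assms(1) by fastforce
  moreover have "\<V> \<noteq> {}"
    using assms(1) [of 1] by auto
  ultimately obtain \<delta> where \<delta>: "0 < \<delta>"
    "\<And>T. T \<subseteq> sphere 0 1 \<Longrightarrow> diameter T < \<delta> \<Longrightarrow> \<exists>V\<in>\<V>. T \<subseteq> V"
    using Lebesgue_number_lemma [of "sphere (0::complex) 1" \<V>, OF compact_sphere] assms(2)
    by metis
  obtain M :: nat where M: "2 * pi / \<delta> < real M"
    using reals_Archimedean2 by blast
  have "0 < 2 * pi / \<delta>"
    using \<delta>(1) by simp
  with M have Mpos: "real M > 0"
    by linarith
  show thesis
  proof
    show "M > 0"
      using Mpos by simp
    show "\<exists>V\<in>\<V>. arc M j \<subseteq> V" for j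
    proof (rule \<delta>(2))
      show "arc M j \<subseteq> sphere 0 1"
        by (auto simp: arc_def)
      have "diameter (arc M j) \<le> 2 * pi / real M"
      proof (rule diameter_le)
        show "arc M j \<noteq> {} \<or> 0 \<le> 2 * pi / real M"
          by simp
        fix u v assume "u \<in> arc M j" "v \<in> arc M j"
        then obtain s t where st: "u = circ s" "v = circ t"
          "s \<in> {real j / real M..real (Suc j) / real M}" "t \<in> {real j / real M..real (Suc j) / real M}"
          by (auto simp: arc_def)
        then have "\<bar>s - t\<bar> \<le> 1 / real M"
          by (auto simp: add_divide_distrib)
        then have "2 * pi * \<bar>s - t\<bar> \<le> 2 * pi * (1 / real M)"
          by (intro mult_left_mono) auto
        then show "norm (u - v) \<le> 2 * pi / real M"
          using dist_circ [of s t] st by (simp add: dist_norm)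
      qed
      also have "\<dots> < \<delta>"
        using M \<delta>(1) Mpos by (simp add: field_simps)
      finally show "diameter (arc M j) < \<delta>" .
    qed
  qed
qed

locale solenoid_covering = solenoid_primes +
  fixes k :: nat and X :: "'a topology" and f :: "'a \<Rightarrow> nat \<Rightarrow> complex"
  assumes k: "k \<ge> 1"
    and covering: "k_fold_covering_map k X (solenoid P) f"
    and connected: "connected_space X"
begin

section \<open>Even coverings and labellings of fibres\<close>

lemma continuous_f: "continuous_map X (solenoid P) f"
  and image_f: "f ` topspace X = S"
  using covering by (auto simp: k_fold_covering_map_def)

lemma f_in_S: "x \<in> topspace X \<Longrightarrow> f x \<in> S"
  using image_f by blast

lemma openin_preimage: "openin (solenoid P) U \<Longrightarrow> openin X {x \<in> topspace X. f x \<in> U}"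
  using continuous_f by (simp add: continuous_map_def)

definition evenly_covered :: "(nat \<Rightarrow> complex) set \<Rightarrow> 'a set set \<Rightarrow> bool" where
  "evenly_covered W \<V> \<longleftrightarrow> openin (solenoid P) W \<and> finite \<V> \<and> card \<V> = k \<and> pairwise disjnt \<V> \<and>
     \<Union>\<V> = {x \<in> topspace X. f x \<in> W} \<and>
     (\<forall>U\<in>\<V>. openin X U \<and> homeomorphic_map (subtopology X U) (subtopology (solenoid P) W) f)"

lemma ex_evenly_covered:
  assumes "y \<in> S"
  shows "\<exists>W. y \<in> W \<and> (\<exists>\<V>. evenly_covered W \<V>)"
proof -
  note covering [unfolded k_fold_covering_map_def]
  from bspec [OF conjunct2 [OF conjunct2 [OF this]] assms]
  show ?thesis
    unfolding evenly_covered_def by (elim exE conjE, intro exI conjI)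
qed

lemma sheet_bij:
  assumes "evenly_covered W \<V>" "U \<in> \<V>"
  shows "f ` U = W" "inj_on f U"
proof -
  have "topspace (subtopology (solenoid P) W) = W" "topspace (subtopology X U) = U"
    using assms by (auto simp: evenly_covered_def openin_subset Int_absorb1)
  moreover have "homeomorphic_map (subtopology X U) (subtopology (solenoid P) W) f"
    using assms by (simp add: evenly_covered_def)
  ultimately show "f ` U = W" "inj_on f U"
    using homeomorphic_imp_surjective_map homeomorphic_imp_injective_map by metis+
qed

text \<open>On each sheet \<open>f\<close> is a homeomorphism onto an open set, so images of small
  open sets are open.\<close>

lemma open_f:
  assumes A: "openin X A"
  shows "openin (solenoid P) (f ` A)"
  unfolding openin_subopen [of _ "f ` A"]
proof clarify
  fix x assume x: "x \<in> A"
  then have xX: "x \<in> topspace X"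
    using A openin_subset by blast
  obtain W \<V> where W: "f x \<in> W" and V: "evenly_covered W \<V>"
    using ex_evenly_covered [OF f_in_S [OF xX]] by blast
  then obtain U where U: "U \<in> \<V>" "x \<in> U"
    using xX unfolding evenly_covered_def by blast
  have "openin X U" "homeomorphic_map (subtopology X U) (subtopology (solenoid P) W) f"
    "openin (solenoid P) W"
    using V U(1) by (auto simp: evenly_covered_def)
  moreover from this have "openin (subtopology X U) (A \<inter> U)"
    using A by (simp add: openin_open_subtopology openin_Int)
  ultimately have "openin (subtopology (solenoid P) W) (f ` (A \<inter> U))"
    using homeomorphic_imp_open_map unfolding open_map_def by blast
  then have "openin (solenoid P) (f ` (A \<inter> U))"
    using \<open>openin (solenoid P) W\<close> by (simp add: openin_open_subtopology)
  then show "\<exists>T. openin (solenoid P) T \<and> f x \<in> T \<and> T \<subseteq> f ` A"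
    using x U by blast
qed

text \<open>The second component of a local trivialisation onto \<open>W\<close> times the discrete
  set \<open>{..<k}\<close>; open level sets express that it is locally constant.\<close>

definition labelling :: "(nat \<Rightarrow> complex) set \<Rightarrow> ('a \<Rightarrow> nat) \<Rightarrow> bool" where
  "labelling W l \<longleftrightarrow> openin (solenoid P) W \<and>
     (\<forall>i. openin X {x \<in> topspace X. f x \<in> W \<and> l x = i}) \<and>
     (\<forall>z\<in>W. bij_betw l {x \<in> topspace X. f x = z} {..<k})"

lemma labelling_bij: "labelling W l \<Longrightarrow> z \<in> W \<Longrightarrow> bij_betw l {x \<in> topspace X. f x = z} {..<k}"
  and labelling_open: "labelling W l \<Longrightarrow> openin X {x \<in> topspace X. f x \<in> W \<and> l x = i}"
  and labelling_openin: "labelling W l \<Longrightarrow> openin (solenoid P) W"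
  by (auto simp: labelling_def)

lemma labelling_less: "labelling W l \<Longrightarrow> x \<in> topspace X \<Longrightarrow> f x \<in> W \<Longrightarrow> l x < k"
  using labelling_bij [of W l "f x"] by (auto simp: bij_betw_def)

lemma labelling_inj:
  "labelling W l \<Longrightarrow> x \<in> topspace X \<Longrightarrow> x' \<in> topspace X \<Longrightarrow> f x \<in> W \<Longrightarrow> f x' = f x \<Longrightarrow> l x' = l x \<Longrightarrow> x' = x"
  using labelling_bij [of W l "f x"] by (auto simp: bij_betw_def inj_on_def)

lemma labelling_surj:
  assumes "labelling W l" "z \<in> W" "i < k"
  obtains x where "x \<in> topspace X" "f x = z" "l x = i"
proof -
  have "i \<in> l ` {x \<in> topspace X. f x = z}"
    using labelling_bij [OF assms(1,2)] assms(3) by (simp add: bij_betw_def)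
  then show thesis
    using that by auto
qed

text \<open>Lets \<open>glued_labellings\<close> rename labels; the form with \<open>inv\<close>
  fits the accumulated transitions that have to be undone there.\<close>

lemma labelling_permute:
  assumes "labelling W l" "\<rho> permutes {..<k}"
  shows "labelling W (\<lambda>x. inv \<rho> (l x))"
  unfolding labelling_def
proof (intro conjI ballI allI)
  show "openin (solenoid P) W"
    using assms(1) by (rule labelling_openin)
  show "openin X {x \<in> topspace X. f x \<in> W \<and> inv \<rho> (l x) = i}" for i
    using labelling_open [OF assms(1), of "\<rho> i"] by (simp add: permutes_inv_eq [OF assms(2)] eq_commute [of "\<rho> i"])
  show "bij_betw (\<lambda>x. inv \<rho> (l x)) {x \<in> topspace X. f x = z} {..<k}" if "z \<in> W" for z
    using bij_betw_trans [OF labelling_bij [OF assms(1) that] permutes_imp_bij [OF permutes_inv [OF assms(2)]]]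
    by (simp add: o_def)
qed

text \<open>The label of a point is the number of its sheet; disjointness of the sheets makes it
  well defined.\<close>

lemma local_labelling:
  assumes "y \<in> S"
  shows "\<exists>W l. y \<in> W \<and> labelling W l"
proof -
  obtain W \<V> where W: "y \<in> W" and E: "evenly_covered W \<V>"
    using ex_evenly_covered [OF assms] by blast
  then have V: "finite \<V>" "card \<V> = k" "pairwise disjnt \<V>"
    "\<Union>\<V> = {x \<in> topspace X. f x \<in> W}" "\<And>U. U \<in> \<V> \<Longrightarrow> openin X U" "openin (solenoid P) W"
    by (auto simp: evenly_covered_def)
  obtain h where h: "bij_betw h \<V> {0..<k}"
    using ex_bij_betw_finite_nat [OF V(1)] V(2) by blast
  define l where "l x = h (SOME U. U \<in> \<V> \<and> x \<in> U)" for x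
  have l: "l x = h U" if "U \<in> \<V>" "x \<in> U" for x U
  proof -
    have "(SOME U. U \<in> \<V> \<and> x \<in> U) = U"
      using that V(3) by (intro some_equality) (auto simp: pairwise_def disjnt_def)
    then show ?thesis
      by (simp add: l_def)
  qed
  have "labelling W l"
    unfolding labelling_def
  proof (intro conjI ballI allI)
    show "openin X {x \<in> topspace X. f x \<in> W \<and> l x = i}" for i
    proof -
      have "{x \<in> topspace X. f x \<in> W \<and> l x = i} = {x \<in> \<Union>\<V>. l x = i}"
        using V(4) by auto
      also have "\<dots> = \<Union>{U \<in> \<V>. h U = i}"
        using l by force
      finally have "{x \<in> topspace X. f x \<in> W \<and> l x = i} = \<Union>{U \<in> \<V>. h U = i}" .
      then show ?thesis
        using V(5) by auto
    qed
    fix z assume z: "z \<in> W"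
    have fib: "\<exists>U\<in>\<V>. x \<in> U" if "x \<in> topspace X" "f x = z" for x
      using V(4) that z by blast
    show "bij_betw l {x \<in> topspace X. f x = z} {..<k}"
      unfolding bij_betw_def
    proof
      show "inj_on l {x \<in> topspace X. f x = z}"
      proof (rule inj_onI)
        fix x x'
        assume x: "x \<in> {x \<in> topspace X. f x = z}" "x' \<in> {x \<in> topspace X. f x = z}" "l x = l x'"
        obtain U U' where U: "U \<in> \<V>" "x \<in> U" "U' \<in> \<V>" "x' \<in> U'"
          using fib x by blast
        then have "h U = h U'"
          using l x(3) by simp
        then have "U = U'"
          using h U by (auto simp: bij_betw_def inj_on_def)
        then show "x = x'"
          using sheet_bij(2) [OF E U(1)] U x by (auto simp: inj_on_def)
      qed
      have "l x < k" if x: "x \<in> topspace X" "f x = z" for x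
      proof -
        obtain U where "U \<in> \<V>" "x \<in> U"
          using fib x by blast
        then show ?thesis
          using l h by (auto simp: bij_betw_def)
      qed
      moreover have "i \<in> l ` {x \<in> topspace X. f x = z}" if i: "i < k" for i
      proof -
        have "i \<in> h ` \<V>"
          using h i by (auto simp: bij_betw_def)
        then obtain U where U: "U \<in> \<V>" "h U = i"
          by blast
        then obtain x where x: "x \<in> U" "f x = z"
          using sheet_bij(1) [OF E] z by blast
        then have "x \<in> topspace X" "l x = i"
          using V(4) U l by auto
        then show ?thesis
          using x by blast
      qed
      ultimately show "l ` {x \<in> topspace X. f x = z} = {..<k}"
        by auto
    qed
  qed (rule V)
  then show ?thesis
    using W by blast
qed

text \<open>Each point \<open>g i\<close> over \<open>y\<close> has a neighbourhood on which both
  labels are constant. Since \<open>f\<close> is open, the images of these \<open>k\<close>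
  neighbourhoods meet in a neighbourhood of \<open>y\<close>, over which \<open>l1\<close>
  determines \<open>l2\<close>.\<close>

lemma local_transition:
  assumes l1: "labelling W1 l1" and l2: "labelling W2 l2" and y: "y \<in> W1" "y \<in> W2"
  shows "\<exists>U \<tau>. openin (solenoid P) U \<and> y \<in> U \<and> (\<forall>x\<in>topspace X. f x \<in> U \<longrightarrow> l2 x = \<tau> (l1 x))"
proof -
  have "\<exists>x. x \<in> topspace X \<and> f x = y \<and> l1 x = i" if "i < k" for i
    using labelling_surj [OF l1 y(1) that] by blast
  then obtain g where g: "\<And>i. i < k \<Longrightarrow> g i \<in> topspace X \<and> f (g i) = y \<and> l1 (g i) = i"
    by metis
  define A where "A i = {x \<in> topspace X. f x \<in> W1 \<and> l1 x = i} \<inter> {x \<in> topspace X. f x \<in> W2 \<and> l2 x = l2 (g i)}" for i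
  define U where "U = W1 \<inter> (\<Inter>i\<in>{..<k}. f ` A i)"
  have "openin (solenoid P) U"
    unfolding U_def A_def using k
    by (intro openin_Int openin_INT2 open_f labelling_open [OF l1] labelling_open [OF l2] labelling_openin [OF l1])
      (auto simp: lessThan_empty_iff)
  moreover have "y \<in> U"
    using g y by (force simp: U_def A_def)
  moreover have "l2 x = l2 (g (l1 x))" if x: "x \<in> topspace X" "f x \<in> U" for x
  proof -
    have "l1 x < k"
      using labelling_less [OF l1] x by (simp add: U_def)
    then have "f x \<in> f ` A (l1 x)"
      using x by (simp add: U_def)
    then obtain x' where "x' \<in> A (l1 x)" "f x' = f x"
      by auto
    then show ?thesis
      using labelling_inj [OF l1, of x x'] x by (auto simp: A_def U_def)
  qed
  ultimately show ?thesis
    by (intro exI [of _ U] exI [of _ "\<lambda>i. l2 (g i)"]) blast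
qed

text \<open>Local labellings exist over small open sets of a single coordinate by
  \<open>uniform_coord\<close>; \<open>fine_arcs\<close> replaces these by equal arcs.\<close>

lemma arc_labellings:
  obtains n M W l where "M > 0" "\<And>j. labelling (W j) (l j)" "\<And>j. {z \<in> S. z n \<in> arc M j} \<subseteq> W j"
    "\<And>j. l (j mod M) = l j"
proof -
  define Q where "Q U \<longleftrightarrow> (\<exists>W l. labelling W l \<and> U \<subseteq> W)" for U
  obtain n where n: "\<And>m w. n \<le> m \<Longrightarrow> norm w = 1 \<Longrightarrow> \<exists>V. open V \<and> w \<in> V \<and> Q {z \<in> S. z m \<in> V}"
  proof (rule uniform_coord [of Q])
    show "\<exists>U. openin (solenoid P) U \<and> y \<in> U \<and> Q U" if "y \<in> S" for y
      using local_labelling [OF that] labelling_openin by (metis Q_def order_refl)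
    show "Q U'" if "Q U" "U' \<subseteq> U" for U U'
      using that unfolding Q_def by (meson order_trans)
  qed auto
  obtain M where M: "M > 0" "\<And>j. \<exists>V\<in>{V. open V \<and> Q {z \<in> S. z n \<in> V}}. arc M j \<subseteq> V"
  proof (rule fine_arcs [of "{V. open V \<and> Q {z \<in> S. z n \<in> V}}"])
    show "\<exists>V\<in>{V. open V \<and> Q {z \<in> S. z n \<in> V}}. w \<in> V" if "norm w = 1" for w
      using n [OF order_refl that] by blast
  qed auto
  have "\<exists>W l. labelling W l \<and> {z \<in> S. z n \<in> arc M j} \<subseteq> W" for j
  proof -
    obtain V where V: "Q {z \<in> S. z n \<in> V}" "arc M j \<subseteq> V"
      using M(2) [of j] by blast
    then obtain W l where "labelling W l" "{z \<in> S. z n \<in> V} \<subseteq> W"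
      unfolding Q_def by blast
    moreover have "{z \<in> S. z n \<in> arc M j} \<subseteq> {z \<in> S. z n \<in> V}"
      using V(2) by auto
    ultimately show ?thesis
      by (meson order_trans)
  qed
  then have "\<forall>j. \<exists>p. labelling (fst p) (snd p) \<and> {z \<in> S. z n \<in> arc M j} \<subseteq> fst p"
    by simp
  from choice [OF this] obtain p
    where p: "\<And>j. labelling (fst (p j)) (snd (p j)) \<and> {z \<in> S. z n \<in> arc M j} \<subseteq> fst (p j)"
    by blast
  show thesis
  proof (rule that [of M "\<lambda>j. fst (p (j mod M))" "\<lambda>j. snd (p (j mod M))" n])
    show "{z \<in> S. z n \<in> arc M j} \<subseteq> fst (p (j mod M))" for j
      using p [of "j mod M"] arc_mod [OF M(1)] by simp
  qed (use M p in auto)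
qed

text \<open>Two neighbouring labellings differ by a locally constant permutation. As it is locally
  constant on a compact space, this permutation depends only on a single coordinate \<open>z m\<close>; since
  neighbouring arcs in that coordinate meet in one point, it becomes constant.\<close>

lemma constant_transitions:
  obtains m M W l \<sigma> where "m\<^sub>0 \<le> m" "M > 0"
    "\<And>j. labelling (W j) (l j)" "\<And>j. {z \<in> S. z m \<in> arc M j} \<subseteq> W j" "\<And>j. l (j mod M) = l j"
    "\<And>j. \<sigma> j permutes {..<k}" "\<And>j. \<sigma> (j mod M) = \<sigma> j"
    "\<And>j x. x \<in> topspace X \<Longrightarrow> f x m = circ (real (Suc j) / real M) \<Longrightarrow> l (Suc j) x = \<sigma> j (l j x)"
proof -
  obtain n M W l where M: "M > 0" and lab: "\<And>j. labelling (W j) (l j)"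
    and W: "\<And>j. {z \<in> S. z n \<in> arc M j} \<subseteq> W j" and per: "\<And>j. l (j mod M) = l j"
    by (rule arc_labellings) blast
  let ?c = "\<lambda>j. circ (real (Suc j) / real M)"
  have c_arc: "?c j \<in> arc M j" "?c j \<in> arc M (Suc j)" for j
    using M by (auto intro!: circ_in_arc divide_right_mono)
  \<comment> \<open>Only points over the junction of arcs \<open>j\<close> and \<open>j + 1\<close>
    are compared. The rule \<open>\<tau>\<close> may still vary from one \<open>U\<close> to
    another.\<close>
  define Q where "Q U \<longleftrightarrow> (\<forall>j\<in>{..<M}. \<exists>\<tau>. \<forall>x\<in>topspace X. f x \<in> U \<longrightarrow> f x n = ?c j \<longrightarrow> l (Suc j) x = \<tau> (l j x))" for U
  obtain m' where m': "\<And>m w. m' \<le> m \<Longrightarrow> norm w = 1 \<Longrightarrow> \<exists>V. open V \<and> w \<in> V \<and> Q {z \<in> S. z m \<in> V}"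
  proof (rule uniform_coord [of Q])
    fix y assume y: "y \<in> S"
    have "\<exists>U \<tau>. openin (solenoid P) U \<and> y \<in> U \<and>
        (\<forall>x\<in>topspace X. f x \<in> U \<longrightarrow> f x n = ?c j \<longrightarrow> l (Suc j) x = \<tau> (l j x))" for j
    proof (cases "y n = ?c j")
      case True
      then have "y \<in> W j" "y \<in> W (Suc j)"
        using W [of j] W [of "Suc j"] c_arc [of j] y by auto
      from local_transition [OF lab lab this] show ?thesis
        by blast
    next
      case False
      \<comment> \<open>Off the junction, a neighbourhood whose coordinate \<open>n\<close> avoids
        \<open>?c j\<close> satisfies the condition vacuously.\<close>
      show ?thesis
        by (rule exI [of _ "{z \<in> S. z n \<in> - {?c j}}"]) (use False y openin_coord [of "- {?c j}" n] in auto)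
    qed
    then have "\<forall>j. \<exists>U. openin (solenoid P) U \<and> y \<in> U \<and>
        (\<exists>\<tau>. \<forall>x\<in>topspace X. f x \<in> U \<longrightarrow> f x n = ?c j \<longrightarrow> l (Suc j) x = \<tau> (l j x))"
      by blast
    from choice [OF this] obtain U where U: "\<And>j. openin (solenoid P) (U j)" "\<And>j. y \<in> U j"
      "\<And>j. \<exists>\<tau>. \<forall>x\<in>topspace X. f x \<in> U j \<longrightarrow> f x n = ?c j \<longrightarrow> l (Suc j) x = \<tau> (l j x)"
      by blast
    have "Q (\<Inter>j\<in>{..<M}. U j)"
      unfolding Q_def
    proof
      fix j assume j: "j \<in> {..<M}"
      then have "\<And>z. z \<in> (\<Inter>j\<in>{..<M}. U j) \<Longrightarrow> z \<in> U j"
        by blast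
      with U(3) [of j] show "\<exists>\<tau>. \<forall>x\<in>topspace X. f x \<in> (\<Inter>j\<in>{..<M}. U j) \<longrightarrow> f x n = ?c j \<longrightarrow> l (Suc j) x = \<tau> (l j x)"
        by meson
    qed
    moreover have "openin (solenoid P) (\<Inter>j\<in>{..<M}. U j)"
      using M U(1) by (intro openin_INT2) (auto simp: lessThan_empty_iff)
    ultimately show "\<exists>U. openin (solenoid P) U \<and> y \<in> U \<and> Q U"
      using U(2) by (intro exI [of _ "\<Inter>j\<in>{..<M}. U j"]) simp
  next
    show "Q U'" if "Q U" "U' \<subseteq> U" for U U'
      unfolding Q_def
    proof
      fix j assume j: "j \<in> {..<M}"
      then have "\<exists>\<tau>. \<forall>x\<in>topspace X. f x \<in> U \<longrightarrow> f x n = ?c j \<longrightarrow> l (Suc j) x = \<tau> (l j x)"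
        using that(1) by (auto simp: Q_def)
      then show "\<exists>\<tau>. \<forall>x\<in>topspace X. f x \<in> U' \<longrightarrow> f x n = ?c j \<longrightarrow> l (Suc j) x = \<tau> (l j x)"
        using that(2) by (meson subsetD)
    qed
  qed auto
  define m where "m = max m\<^sub>0 (max n m')"
  have m: "m\<^sub>0 \<le> m" "n \<le> m" "m' \<le> m"
    by (auto simp: m_def)
  define R where "R = N n m"
  have R: "R > 0" "\<And>z. z \<in> S \<Longrightarrow> z m ^ R = z n"
    using N_pos S_power [OF m(2)] by (auto simp: R_def)
  \<comment> \<open>Coordinate \<open>m\<close> winds \<open>R\<close> times over coordinate
    \<open>n\<close>. With \<open>R * M\<close> arcs, arc \<open>j\<close> in coordinate
    \<open>m\<close> is mapped onto arc \<open>j\<close> in coordinate \<open>n\<close>, so the same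
    \<open>W j\<close> and \<open>l j\<close> still serve.\<close>
  define M' where "M' = R * M"
  have M': "M' > 0"
    using M R by (simp add: M'_def)
  have MM': "real R * (t / real M') = t / real M" for t
    using R(1) by (simp add: M'_def)
  have W': "{z \<in> S. z m \<in> arc M' j} \<subseteq> W j" for j
  proof clarify
    fix z assume z: "z \<in> S" "z m \<in> arc M' j"
    then obtain t where t: "real j / real M' \<le> t" "t \<le> real (Suc j) / real M'" "z m = circ t"
      by (auto simp: arc_def)
    then have "real R * (real j / real M') \<le> real R * t" "real R * t \<le> real R * (real (Suc j) / real M')"
      by (intro mult_left_mono; simp)+
    then have "circ (real R * t) \<in> arc M j"
      unfolding MM' by (intro circ_in_arc) simp
    then have "z n \<in> arc M j"
      using R(2) [OF z(1)] t(3) by (simp add: circ_power)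
    then show "z \<in> W j"
      using W z(1) by blast
  qed
  have per': "l (j mod M') = l j" for j
    using per [of j] per [of "j mod M'"] by (simp add: M'_def mod_mult2_eq mult.commute mod_mod_cancel)
  let ?c' = "\<lambda>j. circ (real (Suc j) / real M')"
  have c'_arc: "?c' j \<in> arc M' j" "?c' j \<in> arc M' (Suc j)" for j
    using M' by (auto intro!: circ_in_arc divide_right_mono)
  have "\<exists>\<sigma>. \<sigma> permutes {..<k} \<and> (\<forall>x\<in>topspace X. f x m = ?c' j \<longrightarrow> l (Suc j) x = \<sigma> (l j x))" for j
  proof -
    obtain V where V: "?c' j \<in> V" "Q {z \<in> S. z m \<in> V}"
      using m'[OF m(3), of "?c' j"] by auto
    have "j mod M \<in> {..<M}"
      using M by simp
    with V(2) obtain \<tau> where \<tau>: "\<forall>x\<in>topspace X. f x \<in> {z \<in> S. z m \<in> V} \<longrightarrow> f x n = ?c (j mod M) \<longrightarrow>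
        l (Suc (j mod M)) x = \<tau> (l (j mod M) x)"
      unfolding Q_def by (drule_tac bspec) auto
    have lS: "l (Suc (j mod M)) = l (Suc j)"
      using per [of "Suc (j mod M)"] per [of "Suc j"] by (simp add: mod_Suc_eq)
    have \<tau>': "l (Suc j) x = \<tau> (l j x)" if x: "x \<in> topspace X" "f x m = ?c' j" for x
    proof -
      have "f x n = circ (real R * (real (Suc j) / real M'))"
        using R(2) [OF f_in_S [OF x(1)]] x(2) by (simp only: circ_power)
      then have "f x n = ?c (j mod M)"
        unfolding MM' circ_Suc_mod [OF M] .
      then show ?thesis
        using \<tau> x V(1) f_in_S [OF x(1)] by (simp add: lS per)
    qed
    \<comment> \<open>One fibre over the junction suffices to see that \<open>\<tau>\<close>
      permutes the labels: both \<open>l j\<close> and \<open>l (Suc j)\<close> are bijective on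
      it.\<close>
    obtain z where z: "z \<in> S" "z m = ?c' j"
      using circ_in_sphere(2) by (rule S_coord_surj)
    have zW: "z \<in> W j" "z \<in> W (Suc j)"
      using W' [of j] W' [of "Suc j"] c'_arc [of j] z by auto
    have inj: "inj_on \<tau> {..<k}"
    proof (rule inj_onI)
      fix a b assume ab: "a \<in> {..<k}" "b \<in> {..<k}" "\<tau> a = \<tau> b"
      obtain x where x: "x \<in> topspace X" "f x = z" "l j x = a"
        using labelling_surj [OF lab zW(1)] ab(1) by auto
      obtain x' where x': "x' \<in> topspace X" "f x' = z" "l j x' = b"
        using labelling_surj [OF lab zW(1)] ab(2) by auto
      have "x' = x"
        using labelling_inj [OF lab, of x x' "Suc j"] x x' z zW(2) ab(3) \<tau>' by simp
      then show "a = b"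
        using x x' by simp
    qed
    have "\<tau> ` {..<k} \<subseteq> {..<k}"
    proof (rule image_subsetI)
      fix a assume "a \<in> {..<k}"
      then have a: "a < k"
        by simp
      obtain x where x: "x \<in> topspace X" "f x = z" "l j x = a"
        using labelling_surj [OF lab zW(1) a] .
      then show "\<tau> a \<in> {..<k}"
        using labelling_less [OF lab, of x "Suc j"] zW(2) \<tau>' [of x] z by simp
    qed
    with inj have "bij_betw \<tau> {..<k} {..<k}"
      by (simp add: bij_betw_def endo_inj_surj)
    \<comment> \<open>\<open>\<tau>\<close> is controlled on labels below \<open>k\<close> only; the
      identity elsewhere completes it to a permutation.\<close>
    then have "bij_betw (\<lambda>i. if i < k then \<tau> i else i) {..<k} {..<k}"
      by (rule bij_betw_cong [THEN iffD1, rotated]) simp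
    then have "(\<lambda>i. if i < k then \<tau> i else i) permutes {..<k}"
      by (rule bij_imp_permutes) simp
    moreover have "l j x < k" if x: "x \<in> topspace X" "f x m = ?c' j" for x
      using labelling_less [OF lab x(1), of j] W' [of j] c'_arc(1) [of j] f_in_S [OF x(1)] x(2) by auto
    ultimately show ?thesis
      using \<tau>' by (intro exI [of _ "\<lambda>i. if i < k then \<tau> i else i"]) simp
  qed
  then obtain \<sigma> where \<sigma>: "\<And>j. \<sigma> j permutes {..<k}"
    "\<And>j. \<forall>x\<in>topspace X. f x m = ?c' j \<longrightarrow> l (Suc j) x = \<sigma> j (l j x)"
    by metis
  show thesis
  proof (rule that [of m M' W l "\<lambda>j. \<sigma> (j mod M')"])
    show "l (Suc j) x = \<sigma> (j mod M') (l j x)" if "x \<in> topspace X" "f x m = ?c' j" for j x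
    proof -
      have "l (Suc (j mod M')) = l (Suc j)"
        using per' [of "Suc (j mod M')"] per' [of "Suc j"] by (simp add: mod_Suc_eq)
      then show ?thesis
        using \<sigma>(2) [of "j mod M'"] that circ_Suc_mod [OF M', of j] by (simp add: per')
    qed
  qed (use m M' lab W' per' \<sigma>(1) in auto)
qed

text \<open>Relabelling arc \<open>j\<close> by the inverse of the composite of the transitions
  \<open>\<sigma> 0\<close> to \<open>\<sigma> (j - 1)\<close> makes neighbouring labels agree. The
  price is due after a full turn: labels over arcs \<open>j\<close> and \<open>j + M\<close> differ
  by the monodromy \<open>\<pi>\<close>, the inverse of the composite over one turn.\<close>

lemma glued_labellings:
  obtains m M W L \<pi> where "m\<^sub>0 \<le> m" "M > 0"
    "\<And>j. labelling (W j) (L j)" "\<And>j. {z \<in> S. z m \<in> arc M j} \<subseteq> W j"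
    "\<And>j x. x \<in> topspace X \<Longrightarrow> f x m = circ (real (Suc j) / real M) \<Longrightarrow> L (Suc j) x = L j x"
    "\<pi> permutes {..<k}" "\<And>j x. L (j + M) x = \<pi> (L j x)"
proof (rule constant_transitions [of m\<^sub>0])
  fix m M W l \<sigma>
  assume *: "m\<^sub>0 \<le> m" "M > 0"
    "\<And>j. labelling (W j) (l j)" "\<And>j. {z \<in> S. z m \<in> arc M j} \<subseteq> W j" "\<And>j. l (j mod M) = l j"
    "\<And>j. \<sigma> j permutes {..<k}" "\<And>j. \<sigma> (j mod M) = \<sigma> j"
    "\<And>j x. x \<in> topspace X \<Longrightarrow> f x m = circ (real (Suc j) / real M) \<Longrightarrow> l (Suc j) x = \<sigma> j (l j x)"
  define \<rho> where "\<rho> = rec_nat id (\<lambda>j \<rho>. \<sigma> j \<circ> \<rho>)"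
  have \<rho>_simps: "\<rho> 0 = id" "\<And>j. \<rho> (Suc j) = \<sigma> j \<circ> \<rho> j"
    by (simp_all add: \<rho>_def)
  have \<rho>: "\<rho> j permutes {..<k}" for j
    by (induction j) (use \<rho>_simps *(6) in \<open>metis permutes_id permutes_compose\<close>)+
  have bij: "bij (\<rho> j)" "bij (\<sigma> j)" for j
    using \<rho> *(6) permutes_bij by blast+
  \<comment> \<open>Periodicity of \<open>\<sigma>\<close> allows the full turn to be composed
    first, so its inverse acts last, on the left of \<open>inv (\<rho> j)\<close>.\<close>
  have \<rho>_add: "\<rho> (j + M) = \<rho> j \<circ> \<rho> M" for j
  proof (induction j)
    case (Suc j)
    have "\<sigma> (j + M) = \<sigma> j"
      using *(7) [of j] *(7) [of "j + M"] by simp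
    with Suc show ?case
      by (simp add: \<rho>_simps o_assoc)
  qed (simp add: \<rho>_simps)
  have l_add: "l (j + M) = l j" for j
    using *(5) [of j] *(5) [of "j + M"] by simp
  show thesis
  proof (rule that [of m M W "\<lambda>j x. inv (\<rho> j) (l j x)" "inv (\<rho> M)"])
    show "labelling (W j) (\<lambda>x. inv (\<rho> j) (l j x))" for j
      by (intro labelling_permute * \<rho>)
    show "inv (\<rho> (Suc j)) (l (Suc j) x) = inv (\<rho> j) (l j x)"
      if "x \<in> topspace X" "f x m = circ (real (Suc j) / real M)" for j x
      using *(8) [OF that] bij by (simp add: \<rho>_simps o_inv_distrib bij_is_inj)
    show "inv (\<rho> (j + M)) (l (j + M) x) = inv (\<rho> M) (inv (\<rho> j) (l j x))" for j x
      using bij by (simp add: \<rho>_add l_add o_inv_distrib)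
  qed (use * \<rho> in \<open>auto intro: permutes_inv\<close>)
qed

end

section \<open>Monodromy\<close>

locale glued_covering = solenoid_covering P k X f
  for P :: "nat \<Rightarrow> nat" and k :: nat and X :: "'a topology" and f :: "'a \<Rightarrow> nat \<Rightarrow> complex" +
  fixes m M :: nat and W :: "nat \<Rightarrow> (nat \<Rightarrow> complex) set" and L :: "nat \<Rightarrow> 'a \<Rightarrow> nat" and \<pi> :: "nat \<Rightarrow> nat"
  assumes M: "M > 0"
    and labelling_L: "labelling (W j) (L j)"
    and arc_W: "{z \<in> S. z m \<in> arc M j} \<subseteq> W j"
    and L_Suc: "x \<in> topspace X \<Longrightarrow> f x m = circ (real (Suc j) / real M) \<Longrightarrow> L (Suc j) x = L j x"
    and permutes: "\<pi> permutes {..<k}"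
    and L_add_M: "L (j + M) x = \<pi> (L j x)"
begin

text \<open>These pairs \<open>(t, x)\<close> form the pull-back of \<open>X\<close> along
  \<open>circ\<close> on the positive half-line; on it, \<open>sheet\<close> is a globally defined
  label.\<close>

definition lift :: "real \<Rightarrow> 'a \<Rightarrow> bool" where
  "lift t x \<longleftrightarrow> x \<in> topspace X \<and> t > 0 \<and> f x m = circ t"

definition sheet :: "real \<Rightarrow> 'a \<Rightarrow> nat" where
  "sheet t x = L (nat \<lfloor>real M * t\<rfloor>) x"

lemma ex_lift: "x \<in> topspace X \<Longrightarrow> \<exists>t. lift t x"
  using circ_surj [OF norm_S [OF f_in_S]] unfolding lift_def by metis

lemma in_unit:
  assumes "t \<ge> 0"
  shows "t \<in> {real (nat \<lfloor>real M * t\<rfloor>) / real M..real (Suc (nat \<lfloor>real M * t\<rfloor>)) / real M}"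
proof -
  have "real M * t \<ge> 0"
    using assms by simp
  then have "real (nat \<lfloor>real M * t\<rfloor>) \<le> real M * t" "real M * t \<le> real (Suc (nat \<lfloor>real M * t\<rfloor>))"
    by linarith+
  then show ?thesis
    using M by (auto simp: field_simps)
qed

lemma sheet_labelling:
  assumes "t > 0"
  obtains V where "labelling V (sheet t)" "\<And>z. z \<in> S \<Longrightarrow> z m = circ t \<Longrightarrow> z \<in> V"
proof
  let ?j = "nat \<lfloor>real M * t\<rfloor>"
  show "labelling (W ?j) (sheet t)"
    unfolding sheet_def [abs_def] by (rule labelling_L)
  show "z \<in> W ?j" if "z \<in> S" "z m = circ t" for z
    using arc_W [of ?j] circ_in_arc [OF in_unit [of t]] assms that by auto
qed

lemma sheet_less:
  assumes "lift t x"
  shows "sheet t x < k"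
proof (rule sheet_labelling [of t])
  show "t > 0"
    using assms by (simp add: lift_def)
  show "sheet t x < k" if "labelling V (sheet t)" "\<And>z. z \<in> S \<Longrightarrow> z m = circ t \<Longrightarrow> z \<in> V" for V
    using labelling_less [OF that(1)] that(2) [OF f_in_S] assms by (simp add: lift_def)
qed

lemma sheet_inj:
  assumes "lift t x" "x' \<in> topspace X" "f x' = f x" "sheet t x' = sheet t x"
  shows "x' = x"
proof (rule sheet_labelling [of t])
  show "t > 0"
    using assms by (simp add: lift_def)
  show "x' = x" if "labelling V (sheet t)" "\<And>z. z \<in> S \<Longrightarrow> z m = circ t \<Longrightarrow> z \<in> V" for V
    using labelling_inj [OF that(1), of x x'] that(2) [OF f_in_S] assms by (simp add: lift_def)
qed

lemma sheet_surj:
  assumes "z \<in> S" "z m = circ t" "t > 0" "i < k"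
  obtains x where "lift t x" "f x = z" "sheet t x = i"
proof (rule sheet_labelling [OF assms(3)])
  fix V assume V: "labelling V (sheet t)" "\<And>z. z \<in> S \<Longrightarrow> z m = circ t \<Longrightarrow> z \<in> V"
  obtain x where "x \<in> topspace X" "f x = z" "sheet t x = i"
    using labelling_surj [OF V(1) V(2) [OF assms(1,2)] assms(4)] .
  then show thesis
    using that assms by (auto simp: lift_def)
qed

lemma sheet_add_1:
  assumes "t \<ge> 0"
  shows "sheet (t + 1) x = \<pi> (sheet t x)"
proof -
  have "real M * t \<ge> 0"
    using assms by simp
  moreover have "\<lfloor>real M * (t + 1)\<rfloor> = \<lfloor>real M * t\<rfloor> + int M"
    by (simp add: ring_distribs)
  ultimately have "nat \<lfloor>real M * (t + 1)\<rfloor> = nat \<lfloor>real M * t\<rfloor> + M"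
    by (simp add: nat_add_distrib)
  then show ?thesis
    by (simp add: sheet_def L_add_M)
qed

text \<open>Lifts of \<open>x\<close> differ by integers, so a quantity unchanged by one turn
  depends on \<open>x\<close> alone. The iteration climbs from the smaller lift, which preserves
  positivity.\<close>

lemma lift_eq_induct:
  assumes s: "lift s x" and t: "lift t x"
    and step: "\<And>t. lift t x \<Longrightarrow> \<phi> (t + 1) = \<phi> t"
  shows "\<phi> s = \<phi> t"
proof -
  have up: "\<phi> (t + real n) = \<phi> t \<and> lift (t + real n) x" if "lift t x" for t n
  proof (induction n)
    case (Suc n)
    have "lift (t + real n + 1) x"
      using Suc circ_add_of_int [of "t + real n" 1] by (simp add: lift_def)
    then show ?case
      using step [of "t + real n"] Suc by (simp add: add_ac)
  qed (use that in simp)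
  obtain n :: int where n: "s = t + of_int n"
    using s t by (auto simp: lift_def circ_eq_iff)
  show ?thesis
  proof (cases "n \<ge> 0")
    case True
    then show ?thesis
      using up [OF t, of "nat n"] n by simp
  next
    case False
    then have "t = s + real (nat (- n))"
      using n by simp
    then show ?thesis
      using up [OF s, of "nat (- n)"] by simp
  qed
qed

text \<open>At the right end point of arc \<open>j\<close> the floor in \<open>sheet\<close> already
  points to arc \<open>j + 1\<close>; there \<open>L_Suc\<close> closes the gap.\<close>

lemma sheet_eq_L:
  assumes "lift t x" "real j \<le> real M * t" "real M * t \<le> real (Suc j)"
  shows "sheet t x = L j x"
proof (cases "real M * t = real (Suc j)")
  case True
  then have "t = real (Suc j) / real M"
    using M by (simp add: field_simps)
  then have "f x m = circ (real (Suc j) / real M)"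
    using assms(1) by (simp only: lift_def)
  then show ?thesis
    using L_Suc [of x j] assms(1) True by (simp add: sheet_def lift_def nat_add_distrib)
next
  case False
  then have "\<lfloor>real M * t\<rfloor> = int j"
    using assms by (simp add: floor_unique)
  then show ?thesis
    by (simp add: sheet_def)
qed

lemma openin_L:
  assumes "lift t x" "real j \<le> real M * t" "real M * t \<le> real (Suc j)"
  shows "openin X {x' \<in> topspace X. f x' \<in> W j \<and> L j x' = sheet t x}"
    "x \<in> {x' \<in> topspace X. f x' \<in> W j \<and> L j x' = sheet t x}"
proof -
  show "openin X {x' \<in> topspace X. f x' \<in> W j \<and> L j x' = sheet t x}"
    by (rule labelling_open [OF labelling_L])
  have "t \<in> {real j / real M..real (Suc j) / real M}"
    using assms M by (auto simp: field_simps)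
  then have "f x \<in> W j"
    using arc_W [of j] circ_in_arc assms(1) f_in_S by (auto simp: lift_def)
  moreover have "L j x = sheet t x"
    using sheet_eq_L [of t x j] assms by simp
  ultimately show "x \<in> {x' \<in> topspace X. f x' \<in> W j \<and> L j x' = sheet t x}"
    using assms(1) by (simp add: lift_def)
qed

lemma local_lift:
  assumes x: "lift t x" and \<epsilon>: "\<epsilon> > 0"
  obtains U where "openin X U" "x \<in> U" "\<And>x'. x' \<in> U \<Longrightarrow> \<exists>t'. lift t' x' \<and> \<bar>t' - t\<bar> < \<epsilon> \<and> sheet t' x' = sheet t x"
proof -
  have t: "t > 0" "real M * t > 0"
    using x M by (auto simp: lift_def)
  \<comment> \<open>Ceiling minus one gives the arc to the left of \<open>t\<close>, floor the arc
    to the right. They coincide unless \<open>t\<close> is a junction, where both labellings are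
    needed.\<close>
  define i where "i = nat (\<lceil>real M * t\<rceil> - 1)"
  define j where "j = nat \<lfloor>real M * t\<rfloor>"
  have i: "real i < real M * t" "real M * t \<le> real (Suc i)"
    using t unfolding i_def by linarith+
  have j: "real j \<le> real M * t" "real M * t < real (Suc j)"
    using t unfolding j_def by linarith+
  have ij: "j = i \<or> j = Suc i"
    using i j by linarith
  \<comment> \<open>Besides respecting \<open>\<epsilon>\<close>, the bound keeps nearby lifts
    positive and strictly inside the union of arcs \<open>i\<close> and \<open>j\<close>.\<close>
  define \<eta> where "\<eta> = min (min \<epsilon> t) (min (t - real i / real M) (real (Suc j) / real M - t))"
  have "\<eta> > 0"
    using \<epsilon> t i j M by (auto simp: \<eta>_def field_simps)
  then obtain \<delta> where \<delta>: "\<delta> > 0" "\<And>w. norm w = 1 \<Longrightarrow> dist w (circ t) < \<delta> \<Longrightarrow> \<exists>s. \<bar>s - t\<bar> < \<eta> \<and> circ s = w"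
    using circ_local_lift [of \<eta> t] by metis
  define U where "U = {x' \<in> topspace X. f x' \<in> W i \<and> L i x' = sheet t x} \<inter>
     {x' \<in> topspace X. f x' \<in> W j \<and> L j x' = sheet t x} \<inter>
     {x' \<in> topspace X. f x' \<in> {z \<in> S. z m \<in> ball (circ t) \<delta>}}"
  show thesis
  proof
    have *: "real i \<le> real M * t" "real M * t \<le> real (Suc j)"
      using i j by simp_all
    show "openin X U"
      unfolding U_def using openin_L [OF x *(1) i(2)] openin_L [OF x j(1) *(2)]
      by (intro openin_Int openin_preimage openin_coord) auto
    show "x \<in> U"
      unfolding U_def using openin_L [OF x *(1) i(2)] openin_L [OF x j(1) *(2)] x \<delta>(1) f_in_S
      by (auto simp: lift_def)
    fix x' assume x': "x' \<in> U"
    then have "x' \<in> topspace X" "f x' \<in> S" "dist (f x' m) (circ t) < \<delta>"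
      by (auto simp: U_def dist_commute)
    then obtain s where s: "\<bar>s - t\<bar> < \<eta>" "circ s = f x' m"
      using \<delta>(2) norm_S by metis
    then have st: "\<bar>s - t\<bar> < \<epsilon>" "s > 0" "real i / real M < s" "s < real (Suc j) / real M"
      unfolding \<eta>_def by linarith+
    have lift: "lift s x'"
      using \<open>x' \<in> topspace X\<close> s(2) st(2) by (simp add: lift_def)
    have b: "real i < real M * s" "real M * s < real (Suc j)"
      using st M by (auto simp: field_simps)
    have "sheet s x' = sheet t x"
    proof (cases "real M * s \<le> real (Suc i)")
      case True
      then show ?thesis
        using sheet_eq_L [OF lift, of i] b x' by (simp add: U_def)
    next
      case False
      then show ?thesis
        using sheet_eq_L [OF lift, of j] b x' ij by (auto simp: U_def)
    qed
    then show "\<exists>t'. lift t' x' \<and> \<bar>t' - t\<bar> < \<epsilon> \<and> sheet t' x' = sheet t x"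
      using lift st(1) by blast
  qed
qed

text \<open>Points having a lift with label in \<open>A\<close> form an open set by
  \<open>local_lift\<close>, and likewise for the complement of \<open>A\<close>. Invariance under
  \<open>\<pi>\<close> makes these two sets disjoint, so connectedness leaves only the
  first.\<close>

lemma sheets_transitive:
  assumes inv: "\<And>a. a < k \<Longrightarrow> \<pi> a \<in> A \<longleftrightarrow> a \<in> A"
    and x0: "lift t\<^sub>0 x\<^sub>0" "sheet t\<^sub>0 x\<^sub>0 \<in> A" and x: "lift t x"
  shows "sheet t x \<in> A"
proof -
  define B where "B C = {x. \<exists>t. lift t x \<and> sheet t x \<in> C}" for C
  have "openin X (B C)" for C
    unfolding openin_subopen [of X "B C"]
  proof
    fix x assume "x \<in> B C"
    then obtain t where t: "lift t x" "sheet t x \<in> C"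
      by (auto simp: B_def)
    obtain U where "openin X U" "x \<in> U"
      "\<And>x'. x' \<in> U \<Longrightarrow> \<exists>t'. lift t' x' \<and> \<bar>t' - t\<bar> < 1 \<and> sheet t' x' = sheet t x"
      using local_lift [OF t(1) zero_less_one] by metis
    then show "\<exists>T. openin X T \<and> x \<in> T \<and> T \<subseteq> B C"
      using t(2) unfolding B_def by (intro exI [of _ U]) force
  qed
  moreover have "B A \<union> B (- A) = topspace X"
    using ex_lift by (auto simp: B_def lift_def)
  moreover have "B A \<inter> B (- A) = {}"
  proof (rule ccontr)
    assume "B A \<inter> B (- A) \<noteq> {}"
    then obtain x s t where st: "lift s x" "lift t x" "sheet s x \<in> A" "sheet t x \<notin> A"
      by (auto simp: B_def)
    have "(sheet s x \<in> A) = (sheet t x \<in> A)"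
      using st(1,2)
    proof (rule lift_eq_induct)
      show "(sheet (t + 1) x \<in> A) = (sheet t x \<in> A)" if "lift t x" for t
        using that inv [OF sheet_less [OF that]] by (simp add: sheet_add_1 lift_def)
    qed
    then show False
      using st by simp
  qed
  moreover have "B A \<noteq> {}"
    using x0 by (auto simp: B_def)
  ultimately have "B (- A) = {}"
    using connected unfolding connected_space_eq by metis
  then show ?thesis
    using x by (auto simp: B_def)
qed

text \<open>By \<open>sheets_transitive\<close> for the orbit of \<open>0\<close>, connectedness of
  \<open>X\<close> forces this orbit to contain every label. Its length is therefore
  \<open>k\<close>, and iterating from \<open>0\<close> lists all labels.\<close>

lemma bij_cycle: "bij_betw (\<lambda>i. (\<pi> ^^ i) 0) {..<k} {..<k}"
  and cycle_k: "(\<pi> ^^ k) 0 = 0"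
proof -
  have perm: "permutation \<pi>"
    using permutes by (auto simp: permutation_permutes)
  have self: "a \<in> orbit \<pi> a" for a
    by (rule permutation_self_in_orbit [OF perm])
  have k0: "0 \<in> {..<k}"
    using k by simp
  \<comment> \<open>Lifts must be positive, so the point 1 of the circle is represented by the angle
    \<open>1\<close> rather than \<open>0\<close>.\<close>
  obtain z where z: "z \<in> S" "z m = circ 1"
    using circ_in_sphere(2) by (rule S_coord_surj)
  have "orbit \<pi> 0 = {..<k}"
  proof
    show "orbit \<pi> 0 \<subseteq> {..<k}"
      by (rule permutes_orbit_subset [OF permutes k0])
    show "{..<k} \<subseteq> orbit \<pi> 0"
    proof
      fix a assume a: "a \<in> {..<k}"
      obtain x\<^sub>0 where x0: "lift 1 x\<^sub>0" "sheet 1 x\<^sub>0 = 0"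
        using sheet_surj [OF z, of 0] k by auto
      obtain x where x: "lift 1 x" "sheet 1 x = a"
        using sheet_surj [OF z, of a] a by auto
      have "\<pi> b \<in> orbit \<pi> 0 \<longleftrightarrow> b \<in> orbit \<pi> 0" for b
        by (metis orbit.step orbit_swap orbit_trans permutation_orbit_step perm self)
      then have "sheet 1 x \<in> orbit \<pi> 0"
        by (rule sheets_transitive [OF _ x0(1) _ x(1)]) (simp_all add: x0 self)
      then show "a \<in> orbit \<pi> 0"
        by (simp add: x)
    qed
  qed
  then have im: "(\<lambda>i. (\<pi> ^^ i) 0) ` {0..<funpow_dist1 \<pi> 0 0} = {..<k}"
    using orbit_conv_funpow_dist1 [OF self] by simp
  have inj: "inj_on (\<lambda>i. (\<pi> ^^ i) 0) {0..<funpow_dist1 \<pi> 0 0}"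
    by (rule inj_on_funpow_dist1 [OF self])
  have d: "funpow_dist1 \<pi> 0 0 = k"
    using card_image [OF inj] im by simp
  show "bij_betw (\<lambda>i. (\<pi> ^^ i) 0) {..<k} {..<k}"
    using im inj unfolding d by (simp add: bij_betw_def lessThan_atLeast0)
  show "(\<pi> ^^ k) 0 = 0"
    using funpow_dist1_prop [OF self, of 0] unfolding d .
qed

text \<open>The position of a label in the cycle started at \<open>0\<close>: a discrete logarithm
  to base \<open>\<pi>\<close>.\<close>

definition ind :: "nat \<Rightarrow> nat" where
  "ind = inv_into {..<k} (\<lambda>i. (\<pi> ^^ i) 0)"

lemma ind_less: "a < k \<Longrightarrow> ind a < k"
  and ind_eq: "a < k \<Longrightarrow> (\<pi> ^^ ind a) 0 = a"
  and ind_funpow: "i < k \<Longrightarrow> ind ((\<pi> ^^ i) 0) = i"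
  using bij_betw_inv_into [OF bij_cycle] bij_betw_inv_into_right [OF bij_cycle]
    bij_betw_inv_into_left [OF bij_cycle]
  by (auto simp: ind_def bij_betw_def)

text \<open>One turn raises the position by one, which cancels against \<open>t + 1\<close>. At the
  end of the cycle the position falls from \<open>k - 1\<close> to \<open>0\<close>, and the
  argument of \<open>circ\<close> grows by exactly one.\<close>

lemma root_step:
  assumes "lift t x"
  shows "circ ((t + 1 - real (ind (sheet (t + 1) x))) / real k) = circ ((t - real (ind (sheet t x))) / real k)"
proof -
  define a where "a = sheet t x"
  have a: "a < k"
    unfolding a_def by (rule sheet_less [OF assms])
  have s: "sheet (t + 1) x = (\<pi> ^^ Suc (ind a)) 0"
    using assms ind_eq [OF a] by (simp add: sheet_add_1 lift_def a_def)
  show ?thesis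
  proof (cases "Suc (ind a) < k")
    case True
    then show ?thesis
      using ind_funpow [OF True] by (simp add: s flip: a_def)
  next
    case False
    then have ka: "k = Suc (ind a)"
      using ind_less [OF a] by simp
    then have "sheet (t + 1) x = 0"
      using cycle_k s by simp
    then have "ind (sheet (t + 1) x) = 0"
      using ind_funpow [of 0] k by simp
    moreover have "(t + 1 - real 0) / real k = (t - real (ind a)) / real k + of_int 1"
      using ka by (simp add: field_simps)
    ultimately show ?thesis
      unfolding a_def by (simp only: circ_add_of_int)
  qed
qed

text \<open>The global \<open>k\<close>-th root of coordinate \<open>m\<close>, with the label
  selecting the branch; \<open>root_eq\<close> shows that the choice of the lift is
  immaterial.\<close>

definition root :: "'a \<Rightarrow> complex" where
  "root x = (let t = SOME t. lift t x in circ ((t - real (ind (sheet t x))) / real k))"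

lemma root_eq:
  assumes "lift t x"
  shows "root x = circ ((t - real (ind (sheet t x))) / real k)"
  unfolding root_def Let_def
  by (rule lift_eq_induct [OF someI [of "\<lambda>t. lift t x", OF assms] assms])
    (rule root_step)

lemma root_power:
  assumes "x \<in> topspace X"
  shows "root x ^ k = f x m"
proof -
  obtain t where t: "lift t x"
    using ex_lift assms by blast
  have "root x ^ k = circ (t + of_int (- int (ind (sheet t x))))"
    using k by (simp add: root_eq [OF t] circ_power)
  also have "\<dots> = f x m"
    using t by (simp only: circ_add_of_int lift_def)
  finally show ?thesis .
qed

text \<open>A \<open>k\<close>-th root \<open>u\<close> of \<open>z m\<close> fixes a position
  \<open>i\<close> in the cycle, hence the label \<open>(\<pi> ^^ i) 0\<close>, and the label
  singles out one point of the fibre over \<open>z\<close>.\<close>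

lemma root_bij:
  assumes z: "z \<in> S" and u: "u ^ k = z m"
  shows "\<exists>!x. x \<in> topspace X \<and> f x = z \<and> root x = u"
proof -
  obtain t where t: "t > 0" "z m = circ t"
    using circ_surj [OF norm_S [OF z]] by metis
  obtain i where i: "i < k" "u = circ ((t - real i) / real k)"
    using circ_roots [OF k, of u t] u t by metis
  have "(\<pi> ^^ i) 0 < k"
    using bij_cycle i(1) by (auto simp: bij_betw_def)
  then obtain x where x: "lift t x" "f x = z" "sheet t x = (\<pi> ^^ i) 0"
    using sheet_surj [OF z t(2,1)] by metis
  have "x = x'" if x': "x' \<in> topspace X" "f x' = z" "root x' = u" for x'
  proof -
    have l: "lift t x'"
      using x' t by (simp add: lift_def)
    then have "ind (sheet t x') = i"
      using circ_roots_distinct [of "ind (sheet t x')" k i t] x'(3) i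
      by (simp add: root_eq ind_less sheet_less)
    then have "sheet t x' = sheet t x"
      using ind_eq [OF sheet_less [OF l]] x(3) by simp
    then show ?thesis
      using sheet_inj [OF x(1) x'(1)] x(2) x'(2) by simp
  qed
  moreover have "x \<in> topspace X" "root x = u"
    using x i by (auto simp: root_eq ind_funpow lift_def)
  ultimately show ?thesis
    using x(2) by blast
qed

text \<open>Nearby points have nearby lifts with the same label, and for a fixed label
  \<open>root\<close> is a Lipschitz function of the lift.\<close>

lemma continuous_root: "continuous_map X euclidean root"
  unfolding continuous_map_def
proof (intro conjI allI impI)
  fix V :: "complex set"
  assume "openin euclidean V"
  then have V: "open V" by simp
  show "openin X {x \<in> topspace X. root x \<in> V}"
    unfolding openin_subopen [of X "{x \<in> topspace X. root x \<in> V}"]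
  proof
    fix x assume x: "x \<in> {x \<in> topspace X. root x \<in> V}"
    then obtain t where t: "lift t x"
      using ex_lift by auto
    obtain e where e: "e > 0" "ball (root x) e \<subseteq> V"
      using V x by (auto simp: open_contains_ball)
    then have "e * real k / (2 * pi) > 0"
      using k by simp
    then obtain U where U: "openin X U" "x \<in> U"
      "\<And>x'. x' \<in> U \<Longrightarrow> \<exists>t'. lift t' x' \<and> \<bar>t' - t\<bar> < e * real k / (2 * pi) \<and> sheet t' x' = sheet t x"
      using local_lift [OF t] by metis
    have "root x' \<in> V" if "x' \<in> U" for x'
    proof -
      from U(3) [OF that]
      obtain t' where t': "lift t' x'" "\<bar>t' - t\<bar> < e * real k / (2 * pi)" "sheet t' x' = sheet t x"
        by blast
      define a where "a = real (ind (sheet t x))"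
      have "(t - a) / real k - (t' - a) / real k = (t - t') / real k"
        by (simp add: diff_divide_distrib)
      then have "dist (root x) (root x') \<le> 2 * pi * \<bar>(t - t') / real k\<bar>"
        using dist_circ [of "(t - a) / real k" "(t' - a) / real k"] t'(3)
        by (simp add: root_eq [OF t] root_eq [OF t'(1)] a_def)
      also have "\<dots> = 2 * pi * \<bar>t' - t\<bar> / real k"
        by (simp add: abs_divide abs_minus_commute)
      also have "\<dots> < e"
        using t'(2) k by (simp add: field_simps)
      finally show ?thesis
        using e(2) by auto
    qed
    then show "\<exists>T. openin X T \<and> x \<in> T \<and> T \<subseteq> {x \<in> topspace X. root x \<in> V}"
      using U openin_subset [OF U(1)] by blast
  qed
qed simp

end

text \<open>Outcome of the monodromy analysis, free of arcs and labels. The parameter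
  \<open>m\<^sub>0\<close> allows the coordinate to be chosen beyond any given index.\<close>

lemma (in solenoid_covering) ex_root:
  obtains m w where "m\<^sub>0 \<le> m" "continuous_map X euclidean w"
    "\<And>x. x \<in> topspace X \<Longrightarrow> w x ^ k = f x m"
    "\<And>z u. z \<in> S \<Longrightarrow> u ^ k = z m \<Longrightarrow> \<exists>!x. x \<in> topspace X \<and> f x = z \<and> w x = u"
proof (rule glued_labellings [of m\<^sub>0])
  fix m M W L \<pi>
  assume m: "m\<^sub>0 \<le> m" and "M > 0"
    "\<And>j. labelling (W j) (L j)" "\<And>j. {z \<in> S. z m \<in> arc M j} \<subseteq> W j"
    "\<And>j x. x \<in> topspace X \<Longrightarrow> f x m = circ (real (Suc j) / real M) \<Longrightarrow> L (Suc j) x = L j x"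
    "\<pi> permutes {..<k}" "\<And>j x. L (j + M) x = \<pi> (L j x)"
  then interpret glued_covering P k X f m M W L \<pi>
    by unfold_locales
  show thesis
    by (rule that [OF m continuous_root root_power root_bij])
qed

section \<open>Roots of points of the solenoid\<close>

lemma continuous_map_mult_complex:
  fixes f g :: "'a \<Rightarrow> complex"
  assumes "continuous_map X euclidean f" "continuous_map X euclidean g"
  shows "continuous_map X euclidean (\<lambda>x. f x * g x)"
proof -
  have "continuous_map X euclidean (\<lambda>x. (f x, g x))"
    using continuous_map_pairedI [OF assms] by simp
  then have "continuous_map X euclidean (\<lambda>x. fst (f x, g x) * snd (f x, g x))"
    by (rule continuous_map_compose_on_UNIV) (intro continuous_intros)
  then show ?thesis
    by simp
qed

lemma continuous_map_finite_image_constant: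
  fixes v :: "'a \<Rightarrow> complex"
  assumes "connected_space X" "continuous_map X euclidean v" "finite F" "v ` topspace X \<subseteq> F"
    and "x \<in> topspace X" "y \<in> topspace X"
  shows "v x = v y"
proof -
  have "connectedin X (topspace X)"
    using assms(1) by (simp only: connectedin_topspace)
  with assms(2) have "connectedin euclidean (v ` topspace X)"
    by (rule connectedin_continuous_map_image)
  then have "connected (v ` topspace X)"
    by simp
  moreover have "finite (v ` topspace X)"
    using assms(3,4) finite_subset by blast
  ultimately have "v ` topspace X = {} \<or> (\<exists>a. v ` topspace X = {a})"
    by (simp add: connected_finite_iff_sing)
  moreover have "v x \<in> v ` topspace X" "v y \<in> v ` topspace X"
    using assms(5,6) by auto
  ultimately show ?thesis
    by (metis empty_iff singletonD)
qed

text \<open>The \<open>k\<close>-th power map of the circle is evenly covered near \<open>c\<close>: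
  \<open>r\<close> is a branch of the \<open>k\<close>-th root, continuous off the ray through
  \<open>- c\<close>, and the sheets are its multiples by roots of unity.\<close>

lemma circle_power_sections:
  assumes c: "norm c = 1" and k: "k \<ge> 1"
  obtains A V r where "open A" "c \<in> A" "\<And>\<zeta>. open (V \<zeta>)"
    "\<And>v \<zeta>. norm v = 1 \<Longrightarrow> \<zeta> ^ k = 1 \<Longrightarrow> v \<in> V \<zeta> \<longleftrightarrow> v ^ k \<in> A \<and> v = \<zeta> * r (v ^ k)"
    "\<And>a. norm a = 1 \<Longrightarrow> r a ^ k = (a :: complex)"
proof -
  obtain t where t: "c = circ t"
    using circ_surj c by metis
  have c0: "c \<noteq> 0"
    using c by auto
  define r where "r a = circ (t / real k) * cis (Arg (a / c) / real k)" for a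
  define A where "A = (\<lambda>a. a / c) -` (- \<real>\<^sub>\<le>\<^sub>0)"
  define R where "R = {\<zeta>::complex. \<zeta> ^ k = 1}"
  \<comment> \<open>For \<open>v\<close> on the circle the quotient \<open>v / r (v ^ k)\<close> is
    a \<open>k\<close>-th root of unity. Excluding the finitely many others, instead of requiring
    the value \<open>\<zeta>\<close>, exhibits the sheet as an open set.\<close>
  define V where "V \<zeta> = {v. v ^ k \<in> A} \<inter> (\<lambda>v. v / r (v ^ k)) -` (- (R - {\<zeta>}))" for \<zeta>
  have r: "r a ^ k = a" if "norm a = 1" for a
  proof -
    have "r a ^ k = c * cis (Arg (a / c))"
      using k by (simp add: r_def power_mult_distrib circ_power Complex.DeMoivre t)
    also have "\<dots> = a"
      using c0 c that by (simp add: cis_Arg_unit norm_divide)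
    finally show ?thesis .
  qed
  have A: "open A"
    unfolding A_def using c0 by (intro open_vimage continuous_intros) auto
  then have kA: "open {v. v ^ k \<in> A}"
    using open_vimage [of A "\<lambda>v. v ^ k"] by (simp add: vimage_def continuous_intros)
  have "continuous_on {v. v ^ k \<in> A} (\<lambda>v. v / r (v ^ k))"
    unfolding r_def using c0 k
    by (intro continuous_intros continuous_on_cis) (auto simp: A_def)
  moreover have "finite R"
    unfolding R_def using k by (intro finite_roots_unity) simp
  ultimately have "open (V \<zeta>)" for \<zeta>
    unfolding V_def
    by (intro continuous_open_preimage kA open_Compl finite_imp_closed finite_Diff)
  moreover have "v \<in> V \<zeta> \<longleftrightarrow> v ^ k \<in> A \<and> v = \<zeta> * r (v ^ k)" if "norm v = 1" "\<zeta> ^ k = 1" for v \<zeta>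
  proof -
    have rv: "r (v ^ k) ^ k = v ^ k"
      using r [of "v ^ k"] that by (simp add: norm_power)
    moreover have "v \<noteq> 0"
      using that by auto
    ultimately have "r (v ^ k) \<noteq> 0"
      using k by (metis power_eq_0_iff zero_less_one order_less_le_trans)
    moreover have "v / r (v ^ k) \<in> R"
      using rv \<open>v \<noteq> 0\<close> by (simp add: R_def power_divide)
    ultimately show ?thesis
      by (auto simp: V_def field_simps)
  qed
  moreover have "c \<in> A"
    using c0 by (simp add: A_def)
  ultimately show thesis
    using A r by (intro that [of A V r])
qed

section \<open>Unique \<open>k\<close>-th roots in a solenoid whose late primes are coprime to
  \<open>k\<close>\<close>

locale coprime_solenoid = solenoid_primes +
  fixes k m :: nat
  assumes k: "k \<ge> 1" and coprime_P: "m \<le> n \<Longrightarrow> coprime (P n) k"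
begin

lemma coprime_N: "m \<le> m' \<Longrightarrow> coprime (N m' n) k"
  unfolding N_def by (intro prod_coprime_left coprime_P) simp

text \<open>As \<open>k\<close> is coprime to \<open>N m' n\<close>, Bezout expresses \<open>y n\<close> through \<open>y n ^ N m' n = y m'\<close>
  and \<open>y n ^ k\<close>. The formula being explicit, no separate argument for continuity is needed.\<close>

lemma coord_formula:
  assumes "m \<le> m'"
  shows "\<exists>a b. \<forall>y\<in>S. y n = y m' ^ a * cnj (y n ^ k) ^ b"
proof (cases "n \<le> m'")
  case True
  then show ?thesis
    using S_power [OF True] by (intro exI [of _ "N n m'"] exI [of _ 0]) simp
next
  case False
  obtain a b where ab: "N m' n * a = k * b + 1"
    using bezout_nat [of "N m' n" k] N_pos [of m' n] coprime_N [OF assms] by (auto simp: coprime_iff_gcd_eq_1)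
  have "y n = y m' ^ a * cnj (y n ^ k) ^ b" if y: "y \<in> S" for y
  proof -
    \<comment> \<open>On the unit circle \<open>cnj\<close> is the inverse, so it removes the
      surplus factor \<open>y n ^ (k * b)\<close> without division.\<close>
    have "y n * cnj (y n) = 1"
      using norm_S [OF y, of n] by (simp add: complex_norm_square [symmetric])
    then have "(y n) ^ (k * b) * cnj (y n) ^ (k * b) = 1"
      by (metis power_mult_distrib power_one)
    then have "y n = y n ^ (k * b + 1) * cnj (y n ^ k) ^ b"
      by (simp add: power_mult)
    also have "y n ^ (k * b + 1) = y m' ^ a"
      using S_power [of m' n y] False y unfolding ab [symmetric] power_mult by simp
    finally show ?thesis .
  qed
  then show ?thesis
    by blast
qed

lemma root_unique:
  assumes "m \<le> m'" "y \<in> S" "y' \<in> S" "limit_map k y = limit_map k y'" "y m' = y' m'"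
  shows "y = y'"
proof
  fix n
  obtain a b where "\<forall>y\<in>S. y n = y m' ^ a * cnj (y n ^ k) ^ b"
    using coord_formula [OF assms(1)] by blast
  moreover have "y n ^ k = y' n ^ k"
    using assms(4) by (metis limit_map_def)
  ultimately show "y n = y' n"
    using assms(2,3,5) by metis
qed

text \<open>Coordinates up to \<open>m'\<close> are powers of \<open>u\<close>. For later
  \<open>n\<close>, a value with \<open>N m' n\<close>-th power \<open>u\<close> and
  \<open>k\<close>-th power \<open>z n\<close> exists by Bezout and is unique by coprimality;
  uniqueness makes successive choices compatible.\<close>

lemma root_exists:
  assumes m: "m \<le> m'" and z: "z \<in> S" and u: "u ^ k = z m'"
  obtains y where "y \<in> S" "limit_map k y = z" "y m' = u"
proof -
  have nu: "norm u = 1"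
    using u norm_S [OF z, of m'] k power_eq_1_iff [of "norm u" k] by (simp flip: norm_power)
  have u0: "u \<noteq> 0"
    using nu by auto
  have ex: "\<exists>v. v ^ N m' n = u \<and> v ^ k = z n" if n: "m' \<le> n" for n
  proof -
    obtain a b where ab: "N m' n * a = k * b + 1"
      using bezout_nat [of "N m' n" k] N_pos [of m' n] coprime_N [OF m] by (auto simp: coprime_iff_gcd_eq_1)
    \<comment> \<open>Since \<open>N m' n * a = k * b + 1\<close>, the \<open>N m' n\<close>-th
      power of this quotient is \<open>u ^ (k * b + 1) / z m' ^ b\<close>, which is \<open>u\<close>
      because \<open>u ^ k = z m'\<close>.\<close>
    define v where "v = u ^ a / z n ^ b"
    have zn: "z n \<noteq> 0" "z m' \<noteq> 0"
      using S_nonzero [OF z] by auto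
    have "v ^ N m' n = u ^ (N m' n * a) / (z n ^ N m' n) ^ b"
      by (simp add: v_def power_divide mult.commute flip: power_mult)
    also have "\<dots> = u"
      unfolding ab S_power [OF n z] using u zn by (simp add: power_add power_mult)
    finally have 1: "v ^ N m' n = u" .
    have "v ^ k = (u ^ k) ^ a / z n ^ (k * b)"
      by (simp add: v_def power_divide mult.commute flip: power_mult)
    also have "(u ^ k) ^ a = z n ^ (N m' n * a)"
      unfolding u using S_power [OF n z] by (simp add: power_mult)
    also have "z n ^ (N m' n * a) / z n ^ (k * b) = z n"
      unfolding ab using zn by simp
    finally show ?thesis
      using 1 by blast
  qed
  define Y where "Y n = (SOME v. v ^ N m' n = u \<and> v ^ k = z n)" for n
  have Y: "Y n ^ N m' n = u" "Y n ^ k = z n" if "m' \<le> n" for n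
    using someI_ex [OF ex [OF that]] by (simp_all add: Y_def)
  define y where "y n = (if n \<le> m' then u ^ N n m' else Y n)" for n
  have Ym: "Y m' = u"
    using Y(1) [of m'] by (simp add: N_def)
  have ynorm: "norm (y n) = 1" for n
  proof (cases "n \<le> m'")
    case True
    then show ?thesis
      using nu by (simp add: y_def norm_power)
  next
    case False
    then show ?thesis
      using Y(2) [of n] norm_S [OF z, of n] k power_eq_1_iff [of "norm (Y n)" k]
      by (simp add: y_def flip: norm_power)
  qed
  have yY: "y n = Y n" if "m' \<le> n" for n
    using that Ym by (cases "n = m'") (auto simp: y_def N_def)
  have yk: "y n ^ k = z n" for n
  proof (cases "n \<le> m'")
    case True
    then have "y n ^ k = (u ^ k) ^ N n m'"
      by (simp add: y_def mult.commute flip: power_mult)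
    then show ?thesis
      using u S_power [OF True z] by simp
  next
    case False
    then show ?thesis
      using Y(2) yY by simp
  qed
  have "y (Suc n) ^ P n = y n" for n
  proof (cases "Suc n \<le> m'")
    case True
    then have "N n m' = P n * N (Suc n) m'"
      by (simp add: N_def prod.atLeast_Suc_lessThan)
    then show ?thesis
      using True by (simp add: y_def mult.commute flip: power_mult)
  next
    case False
    then have n: "m' \<le> n"
      by simp
    have "y (Suc n) ^ P n = Y (Suc n) ^ P n"
      using yY n by simp
    also have "\<dots> = Y n"
    proof (rule power_eq_cancel_coprime [OF coprime_N [OF m]])
      show "(Y (Suc n) ^ P n) ^ N m' n = Y n ^ N m' n"
        using Y(1) [of n] Y(1) [of "Suc n"] n by (simp add: N_Suc mult.commute flip: power_mult)
      have "(Y (Suc n) ^ P n) ^ k = (Y (Suc n) ^ k) ^ P n"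
        by (simp add: mult.commute flip: power_mult)
      then show "(Y (Suc n) ^ P n) ^ k = Y n ^ k"
        using Y(2) n S_step [OF z] by simp
      show "Y n \<noteq> 0"
        using ynorm [of n] yY [OF n] by auto
    qed
    finally show ?thesis
      using yY [OF n] by simp
  qed
  then have "y \<in> S"
    using ynorm by (simp add: topspace_solenoid)
  moreover have "limit_map k y = z"
    using yk by (simp add: limit_map_def)
  moreover have "y m' = u"
    using Ym yY [of m'] by simp
  ultimately show thesis
    by (rule that)
qed

section \<open>The limit map as a covering map\<close>

lemma limit_map_in_S: "z \<in> S \<Longrightarrow> limit_map k z \<in> S"
  by (auto simp: topspace_solenoid limit_map_def norm_power) (metis mult.commute power_mult)

lemma continuous_limit_map: "continuous_map (solenoid P) (solenoid P) (limit_map k)"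
  unfolding continuous_map_solenoid
proof (intro conjI allI)
  show "limit_map k \<in> S \<rightarrow> S"
    using limit_map_in_S by auto
  show "continuous_map (solenoid P) euclidean (\<lambda>z. limit_map k z n)" for n
    unfolding limit_map_def
    by (rule continuous_map_compose_on_UNIV [OF continuous_map_coord]) (intro continuous_intros)
qed

lemma limit_map_surj: "limit_map k ` S = S"
proof
  show "S \<subseteq> limit_map k ` S"
  proof
    fix z assume z: "z \<in> S"
    obtain t where "z m = circ t"
      using circ_surj [OF norm_S [OF z]] by metis
    then have "circ (t / real k) ^ k = z m"
      using k by (simp add: circ_power)
    then obtain y where "y \<in> S" "limit_map k y = z"
      by (rule root_exists [OF order_refl z])
    then show "z \<in> limit_map k ` S"
      by blast
  qed
qed (use limit_map_in_S in auto)

lemma closed_limit_map: "closed_map (solenoid P) (solenoid P) (limit_map k)"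
  by (rule continuous_imp_closed_map [OF continuous_limit_map compact_solenoid Hausdorff_solenoid])

text \<open>A point \<open>x\<close> is determined by \<open>limit_map k x\<close> together with
  \<open>x m\<close>, and every compatible pair occurs. So the even coverings of the circle by the
  \<open>k\<close>-th power map pull back along coordinate \<open>m\<close>, with one sheet
  \<open>U \<zeta>\<close> for each \<open>k\<close>-th root of unity.\<close>

lemma covering_limit_map: "k_fold_covering_map k (solenoid P) (solenoid P) (limit_map k)"
  unfolding k_fold_covering_map_def
proof (intro conjI ballI continuous_limit_map limit_map_surj)
  fix y assume y: "y \<in> S"
  define R where "R = {\<zeta>::complex. \<zeta> ^ k = 1}"
  have R: "finite R" "card R = k"
    using k by (auto simp: R_def card_roots_unity_eq intro!: finite_roots_unity)
  obtain A V r where A: "open A" "y m \<in> A" and V: "\<And>\<zeta>. open (V \<zeta>)"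
    and VA: "\<And>v \<zeta>. norm v = 1 \<Longrightarrow> \<zeta> ^ k = 1 \<Longrightarrow> v \<in> V \<zeta> \<longleftrightarrow> v ^ k \<in> A \<and> v = \<zeta> * r (v ^ k)"
    and r: "\<And>a. norm a = 1 \<Longrightarrow> r a ^ k = a"
    using circle_power_sections [OF norm_S [OF y] k] by metis
  define W where "W = {z \<in> S. z m \<in> A}"
  define U where "U \<zeta> = {x \<in> S. x m \<in> V \<zeta>}" for \<zeta>
  have opW: "openin (solenoid P) W" and opU: "\<And>\<zeta>. openin (solenoid P) (U \<zeta>)"
    unfolding W_def U_def using A V by (auto intro: openin_coord)
  have U_iff: "x \<in> U \<zeta> \<longleftrightarrow> x \<in> S \<and> limit_map k x \<in> W \<and> x m = \<zeta> * r (x m ^ k)" if "\<zeta> \<in> R" for x \<zeta>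
    using that VA norm_S limit_map_in_S by (auto simp: U_def W_def R_def limit_map_def)
  have r0: "r (x m ^ k) \<noteq> 0" if "x \<in> S" for x
    using r [of "x m ^ k"] norm_S [OF that, of m] S_nonzero [OF that, of m] k
    by (auto simp: norm_power zero_power)
  have disj: "\<zeta> = \<zeta>'" if "\<zeta> \<in> R" "\<zeta>' \<in> R" "x \<in> U \<zeta>" "x \<in> U \<zeta>'" for \<zeta> \<zeta>' x
    using that U_iff r0 [of x] by (metis mult_right_cancel)
  have cover: "\<exists>\<zeta>\<in>R. x \<in> U \<zeta>" if x: "x \<in> S" "limit_map k x \<in> W" for x
  proof -
    have "x m / r (x m ^ k) \<in> R"
      using r [of "x m ^ k"] norm_S [OF x(1), of m] S_nonzero [OF x(1), of m]
      by (simp add: R_def power_divide norm_power)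
    then show ?thesis
      using U_iff x r0 [OF x(1)] by (intro bexI [of _ "x m / r (x m ^ k)"]) auto
  qed
  have im: "limit_map k ` U \<zeta> = W" if \<zeta>: "\<zeta> \<in> R" for \<zeta>
  proof
    show "limit_map k ` U \<zeta> \<subseteq> W"
      using U_iff [OF \<zeta>] by auto
    show "W \<subseteq> limit_map k ` U \<zeta>"
    proof
      fix z assume z: "z \<in> W"
      then have zS: "z \<in> S"
        by (simp add: W_def)
      have "(\<zeta> * r (z m)) ^ k = z m"
        using \<zeta> r [OF norm_S [OF zS]] by (simp add: R_def power_mult_distrib)
      then obtain x where x: "x \<in> S" "limit_map k x = z" "x m = \<zeta> * r (z m)"
        by (rule root_exists [OF order_refl zS])
      then have "x m ^ k = z m"
        by (auto simp: limit_map_def)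
      then have "x \<in> U \<zeta>"
        using U_iff [OF \<zeta>] x z by simp
      then show "z \<in> limit_map k ` U \<zeta>"
        using x(2) by blast
    qed
  qed
  have inj: "inj_on (limit_map k) (U \<zeta>)" if \<zeta>: "\<zeta> \<in> R" for \<zeta>
  proof (rule inj_onI)
    fix x x' assume x: "x \<in> U \<zeta>" "x' \<in> U \<zeta>" and eq: "limit_map k x = limit_map k x'"
    then have "x m ^ k = x' m ^ k"
      by (metis limit_map_def)
    then have "x m = x' m"
      using x U_iff [OF \<zeta>] by metis
    then show "x = x'"
      using root_unique [OF order_refl _ _ eq] x by (simp add: U_def)
  qed
  have top: "topspace (subtopology (solenoid P) W) = W" "topspace (subtopology (solenoid P) (U \<zeta>)) = U \<zeta>" for \<zeta>
    by (auto simp: W_def U_def)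
  have homeo: "homeomorphic_map (subtopology (solenoid P) (U \<zeta>)) (subtopology (solenoid P) W) (limit_map k)"
    if \<zeta>: "\<zeta> \<in> R" for \<zeta>
  proof (rule bijective_closed_imp_homeomorphic_map)
    show "continuous_map (subtopology (solenoid P) (U \<zeta>)) (subtopology (solenoid P) W) (limit_map k)"
      using im [OF \<zeta>] top
      by (auto simp: continuous_map_in_subtopology intro: continuous_map_from_subtopology continuous_limit_map)
    show "closed_map (subtopology (solenoid P) (U \<zeta>)) (subtopology (solenoid P) W) (limit_map k)"
      unfolding closed_map_def
    proof (intro allI impI)
      fix C assume "closedin (subtopology (solenoid P) (U \<zeta>)) C"
      then obtain K where K: "closedin (solenoid P) K" "C = K \<inter> U \<zeta>"
        by (auto simp: closedin_subtopology)
      \<comment> \<open>Removing the other open sheets from \<open>K\<close> keeps it closed and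
        leaves, over \<open>W\<close>, exactly \<open>C\<close>. Closedness of the image then comes
        from the closed map on the whole compact solenoid.\<close>
      define K' where "K' = K - (\<Union>\<zeta>'\<in>R - {\<zeta>}. U \<zeta>')"
      have "closedin (solenoid P) K'"
        unfolding K'_def using K(1) opU by (intro closedin_diff openin_Union) auto
      then have "closedin (solenoid P) (limit_map k ` K')"
        using closed_limit_map by (simp add: closed_map_def)
      moreover have "limit_map k ` C = limit_map k ` K' \<inter> W"
      proof
        show "limit_map k ` C \<subseteq> limit_map k ` K' \<inter> W"
          using disj [OF \<zeta>] im [OF \<zeta>] by (auto simp: K(2) K'_def)
        show "limit_map k ` K' \<inter> W \<subseteq> limit_map k ` C"
        proof clarify
          fix x assume x: "x \<in> K'" "limit_map k x \<in> W"
          have "x \<in> S"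
            using x(1) K(1) closedin_subset by (auto simp: K'_def)
          then obtain \<zeta>' where "\<zeta>' \<in> R" "x \<in> U \<zeta>'"
            using cover x(2) by blast
          then have "x \<in> U \<zeta>"
            using x(1) by (auto simp: K'_def)
          then show "limit_map k x \<in> limit_map k ` C"
            using x(1) by (auto simp: K(2) K'_def)
        qed
      qed
      ultimately show "closedin (subtopology (solenoid P) W) (limit_map k ` C)"
        by (auto simp: closedin_subtopology)
    qed
  qed (use im [OF \<zeta>] inj [OF \<zeta>] top in auto)
  \<comment> \<open>The sheets form a set, so counting them requires distinct \<open>\<zeta>\<close>
    to give distinct \<open>U \<zeta>\<close>.\<close>
  have "inj_on U R"
  proof (rule inj_onI)
    fix \<zeta> \<zeta>' assume "\<zeta> \<in> R" "\<zeta>' \<in> R" "U \<zeta> = U \<zeta>'"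
    moreover have "U \<zeta> \<noteq> {}"
      using im [OF \<open>\<zeta> \<in> R\<close>] y A(2) by (auto simp: W_def)
    ultimately show "\<zeta> = \<zeta>'"
      using disj by blast
  qed
  then have card: "card (U ` R) = k"
    using R(2) by (simp add: card_image)
  have pw: "pairwise disjnt (U ` R)"
    using disj by (fastforce simp: pairwise_def disjnt_def)
  have un: "\<Union>(U ` R) = {x \<in> S. limit_map k x \<in> W}"
    using cover U_iff by blast
  show "\<exists>W. openin (solenoid P) W \<and> y \<in> W \<and>
        (\<exists>\<V>. finite \<V> \<and> card \<V> = k \<and> pairwise disjnt \<V> \<and>
             \<Union>\<V> = {x \<in> topspace (solenoid P). limit_map k x \<in> W} \<and>
             (\<forall>U\<in>\<V>. openin (solenoid P) U \<and>
                homeomorphic_map (subtopology (solenoid P) U) (subtopology (solenoid P) W) (limit_map k)))"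
    using opW y A(2) R(1) card pw un opU homeo
    by (intro exI [of _ W] conjI exI [of _ "U ` R"]) (auto simp: W_def)
qed

lemma connected_covering_limit_map:
  "k_fold_connected_covering k (solenoid P) (solenoid P) (limit_map k)"
  unfolding k_fold_connected_covering_def
  using metrizable_solenoid connected_solenoid covering_limit_map by blast

text \<open>The sheet of \<open>limit_map k\<close> through \<open>y\<close> serves as
  \<open>Q\<close>; it localises the openness argument in
  \<open>equivalent_to_limit_map\<close>.\<close>

lemma limit_map_locally_inj:
  assumes "y \<in> S"
  obtains Q where "openin (solenoid P) Q" "y \<in> Q" "inj_on (limit_map k) Q"
proof -
  interpret h: solenoid_covering P k "solenoid P" "limit_map k"
    using k covering_limit_map connected_solenoid by unfold_locales
  obtain W \<V> where W: "limit_map k y \<in> W" "h.evenly_covered W \<V>"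
    using h.ex_evenly_covered [OF limit_map_in_S [OF assms]] by blast
  then obtain U where "U \<in> \<V>" "y \<in> U"
    using assms unfolding h.evenly_covered_def by blast
  then show thesis
    using that [of U] W(2) h.sheet_bij(2) by (auto simp: h.evenly_covered_def)
qed

text \<open>Both total spaces correspond to the pairs \<open>(z, u)\<close> with
  \<open>u ^ k = z m'\<close>, by \<open>(f, w)\<close> on one side and by
  \<open>limit_map k\<close> with coordinate \<open>m'\<close> on the other. Matching the pairs
  gives \<open>g\<close>.\<close>

lemma equivalent_to_limit_map:
  assumes "k_fold_connected_covering k X (solenoid P) f"
  shows "equivalent_coverings X f (solenoid P) (limit_map k)"
proof -
  interpret c: solenoid_covering P k X f
    using k assms by unfold_locales (auto simp: k_fold_connected_covering_def)
  show ?thesis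
  proof (rule c.ex_root [of m])
    fix m' w
    assume m: "m \<le> m'" and w: "continuous_map X euclidean w"
      and wk: "\<And>x. x \<in> topspace X \<Longrightarrow> w x ^ k = f x m'"
      and bij: "\<And>z u. z \<in> S \<Longrightarrow> u ^ k = z m' \<Longrightarrow> \<exists>!x. x \<in> topspace X \<and> f x = z \<and> w x = u"
    have "\<exists>y. y \<in> S \<and> limit_map k y = f x \<and> y m' = w x" if "x \<in> topspace X" for x
      using root_exists [OF m c.f_in_S [OF that] wk [OF that]] by metis
    then obtain g where g: "\<And>x. x \<in> topspace X \<Longrightarrow> g x \<in> S \<and> limit_map k (g x) = f x \<and> g x m' = w x"
      by metis
    have cont: "continuous_map X (solenoid P) g"
      unfolding continuous_map_solenoid
    proof (intro conjI allI)
      fix n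
      obtain a b where ab: "\<forall>y\<in>S. y n = y m' ^ a * cnj (y n ^ k) ^ b"
        using coord_formula [OF m] by blast
      have fn: "continuous_map X euclidean (\<lambda>x. f x n)"
        using c.continuous_f by (simp add: continuous_map_solenoid)
      \<comment> \<open>\<open>coord_formula\<close> expresses \<open>g x n\<close> through
        \<open>g x m' = w x\<close> and \<open>g x n ^ k = f x n\<close>, both continuous in
        \<open>x\<close>.\<close>
      have "continuous_map X euclidean (\<lambda>x. w x ^ a * cnj (f x n) ^ b)"
        by (intro continuous_map_mult_complex continuous_map_compose_on_UNIV [OF w]
            continuous_map_compose_on_UNIV [OF fn] continuous_intros)
      moreover have "w x ^ a * cnj (f x n) ^ b = g x n" if "x \<in> topspace X" for x
      proof -
        have "g x n ^ k = f x n"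
          using g [OF that] by (metis limit_map_def)
        then show ?thesis
          using g [OF that] ab by metis
      qed
      ultimately show "continuous_map X euclidean (\<lambda>x. g x n)"
        by (rule continuous_map_eq)
    qed (use g in auto)
    have "homeomorphic_map X (solenoid P) g"
    proof (rule bijective_open_imp_homeomorphic_map [OF cont])
      show "inj_on g (topspace X)"
      proof (rule inj_onI)
        fix x x' assume x: "x \<in> topspace X" "x' \<in> topspace X" "g x = g x'"
        then have "f x = f x'" "w x = w x'"
          using g by metis+
        then show "x = x'"
          using bij [OF c.f_in_S [OF x(1)] wk [OF x(1)]] x by metis
      qed
      show "g ` topspace X = S"
      proof
        show "S \<subseteq> g ` topspace X"
        proof
          fix y assume y: "y \<in> S"
          have "y m' ^ k = limit_map k y m'"
            by (simp add: limit_map_def)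
          from bij [OF limit_map_in_S [OF y] this]
          obtain x where x: "x \<in> topspace X" "f x = limit_map k y" "w x = y m'"
            by blast
          then have "g x = y"
            using root_unique [OF m, of "g x" y] g [OF x(1)] y by simp
          then show "y \<in> g ` topspace X"
            using x(1) by blast
        qed
      qed (use g in auto)
      show "open_map X (solenoid P) g"
        unfolding open_map_def
      proof (intro allI impI)
        fix B assume B: "openin X B"
        show "openin (solenoid P) (g ` B)"
          unfolding openin_subopen [of _ "g ` B"]
        proof clarify
          fix x assume x: "x \<in> B"
          then have xX: "x \<in> topspace X"
            using B openin_subset by blast
          obtain Q where Q: "openin (solenoid P) Q" "g x \<in> Q" "inj_on (limit_map k) Q"
            using limit_map_locally_inj g [OF xX] by metis
          \<comment> \<open>On \<open>B'\<close>, \<open>g\<close> is \<open>f\<close> followed by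
            the inverse of \<open>limit_map k\<close> on \<open>Q\<close>; thus openness of
            \<open>f\<close> yields openness of \<open>g\<close>.\<close>
          define B' where "B' = B \<inter> {x \<in> topspace X. g x \<in> Q}"
          have "openin X B'"
            unfolding B'_def using B Q(1) cont by (simp add: continuous_map_def openin_Int)
          then have "openin (solenoid P) (f ` B')"
            by (rule c.open_f)
          then have "openin (solenoid P) {q \<in> S. limit_map k q \<in> f ` B'}"
            using continuous_limit_map by (simp add: continuous_map_def)
          then have "openin (solenoid P) (Q \<inter> {q \<in> S. limit_map k q \<in> f ` B'})"
            using Q(1) by (rule openin_Int [rotated])
          moreover have "g x \<in> Q \<inter> {q \<in> S. limit_map k q \<in> f ` B'}"
            using Q(2) g [OF xX] x xX by (auto simp: B'_def)
          moreover have "Q \<inter> {q \<in> S. limit_map k q \<in> f ` B'} \<subseteq> g ` B"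
          proof clarify
            fix q b assume q: "q \<in> Q" "limit_map k q = f b" and b: "b \<in> B'"
            then have "limit_map k q = limit_map k (g b)" "g b \<in> Q"
              using g by (auto simp: B'_def)
            then have "q = g b"
              using Q(3) q(1) by (meson inj_onD)
            then show "q \<in> g ` B"
              using b by (auto simp: B'_def)
          qed
          ultimately show "\<exists>T. openin (solenoid P) T \<and> g x \<in> T \<and> T \<subseteq> g ` B"
            by blast
        qed
      qed
    qed
    then show ?thesis
      unfolding equivalent_coverings_def using g by metis
  qed
qed

end

text \<open>With \<open>P i = p\<close>, a \<open>p\<close>-th root of \<open>f x m\<close> is the
  \<open>N m i\<close>-th power of coordinate \<open>Suc i\<close>. Comparing it with
  \<open>w x ^ q\<close> gives the contradiction within a single fibre.\<close>

lemma (in solenoid_covering) no_infinite_prime_divisor: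
  assumes p: "prime p" "occurs_infinitely_often p P" "p dvd k"
  shows False
proof (rule ex_root [of 0])
  fix m w
  assume w: "continuous_map X euclidean w" and wk: "\<And>x. x \<in> topspace X \<Longrightarrow> w x ^ k = f x m"
    and bij: "\<And>z u. z \<in> S \<Longrightarrow> u ^ k = z m \<Longrightarrow> \<exists>!x. x \<in> topspace X \<and> f x = z \<and> w x = u"
  obtain i where i: "m \<le> i" "P i = p"
    using p(2) unfolding occurs_infinitely_often_def infinite_nat_iff_unbounded_le by auto
  obtain q where q: "k = p * q"
    using p(3) by blast
  have p2: "real p \<ge> 2"
    using prime_ge_2_nat [OF p(1)] by simp
  \<comment> \<open>The quotient of \<open>w x ^ q\<close> by that root; \<open>cnj\<close> inverts
    on the unit circle and is continuous everywhere.\<close>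
  define v where "v x = w x ^ q * cnj (f x (Suc i)) ^ N m i" for x
  have fn: "continuous_map X euclidean (\<lambda>x. f x n)" for n
    using continuous_f by (simp add: continuous_map_solenoid)
  have cont: "continuous_map X euclidean v"
    unfolding v_def
    by (intro continuous_map_mult_complex continuous_map_compose_on_UNIV [OF w]
        continuous_map_compose_on_UNIV [OF fn] continuous_intros)
  have vp: "v x ^ p = 1" if x: "x \<in> topspace X" for x
  proof -
    have "v x ^ p = w x ^ k * cnj ((f x (Suc i) ^ P i) ^ N m i)"
      by (simp add: v_def q i(2) power_mult_distrib mult.commute flip: power_mult)
    also have "(f x (Suc i) ^ P i) ^ N m i = f x m"
      using S_step S_power [OF i(1)] f_in_S [OF x] by simp
    also have "w x ^ k * cnj (f x m) = 1"
      using wk [OF x] norm_S [OF f_in_S [OF x], of m] by (simp add: complex_norm_square [symmetric])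
    finally show ?thesis .
  qed
  obtain z where z: "z \<in> S" "z m = circ 0"
    using circ_in_sphere(2) by (rule S_coord_surj)
  have z1: "z m = 1"
    using z circ_of_nat [of 0] by simp
  obtain x where x: "x \<in> topspace X" "f x = z" "w x = 1"
    using bij [OF z(1), of 1] z1 by auto
  have "circ (1 / real k) ^ k = z m"
    using k circ_of_nat [of 1] by (simp add: circ_power z1)
  then obtain x' where x': "x' \<in> topspace X" "f x' = z" "w x' = circ (1 / real k)"
    using bij [OF z(1)] by blast
  \<comment> \<open>Over the same \<open>z\<close> the second factors of \<open>v\<close> agree, so
    equality forces \<open>w x' ^ q = w x ^ q\<close>, that is,
    \<open>circ (1 / p) = 1\<close>.\<close>
  have "v x' = v x"
  proof (rule continuous_map_finite_image_constant [OF connected cont _ _ x'(1) x(1)])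
    show "finite {c::complex. c ^ p = 1}"
      using p2 by (intro finite_roots_unity) simp
    show "v ` topspace X \<subseteq> {c. c ^ p = 1}"
      using vp by auto
  qed
  then have "circ (1 / real k) ^ q = 1"
    using x x' S_nonzero [OF z(1)] by (simp add: v_def)
  moreover have "circ (1 / real k) ^ q = circ (1 / real p)"
    using k q by (auto simp: circ_power)
  ultimately have "circ (1 / real p) = circ 0"
    using circ_of_nat [of 0] by simp
  then obtain n :: int where n: "1 / real p = of_int n"
    by (auto simp: circ_eq_iff)
  have "0 < 1 / real p" "1 / real p < 1"
    using p2 by auto
  then show False
    unfolding n by simp
qed

theorem theorem2:
  fixes P :: "nat \<Rightarrow> nat" and k :: nat
  assumes "\<And>n. prime (P n)" and "k \<ge> 1"
  shows "if \<exists>p. prime p \<and> occurs_infinitely_often p P \<and> p dvd k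
         then \<not> (\<exists>(X :: 'a topology) f. k_fold_connected_covering k X (solenoid P) f)
         else k_fold_connected_covering k (solenoid P) (solenoid P) (limit_map k) \<and>
              (\<forall>(X :: 'a topology) f. k_fold_connected_covering k X (solenoid P) f \<longrightarrow>
                 equivalent_coverings X f (solenoid P) (limit_map k))"
proof (cases "\<exists>p. prime p \<and> occurs_infinitely_often p P \<and> p dvd k")
  case True
  then obtain p where p: "prime p" "occurs_infinitely_often p P" "p dvd k"
    by blast
  have False if "k_fold_connected_covering k X (solenoid P) f" for X :: "'a topology" and f
  proof -
    interpret solenoid_covering P k X f
      using that assms by unfold_locales (auto simp: k_fold_connected_covering_def)
    show False
      by (rule no_infinite_prime_divisor [OF p])
  qed
  then show ?thesis
    using True by auto
next
  case False
  \<comment> \<open>Finitely many primes divide \<open>k\<close> and each occurs finitely often, so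
    from some index \<open>m\<close> on no \<open>P n\<close> divides \<open>k\<close>.\<close>
  have "{n. P n dvd k} = (\<Union>p\<in>{p. p dvd k \<and> prime p}. {n. P n = p})"
    using assms(1) by auto
  also have "finite \<dots>"
    using False assms(2) by (auto simp: occurs_infinitely_often_def)
  finally obtain m where m: "\<And>n. P n dvd k \<Longrightarrow> n < m"
    by (auto simp: finite_nat_set_iff_bounded)
  interpret coprime_solenoid P k m
    using assms m by unfold_locales (auto intro: prime_imp_coprime simp: not_less [symmetric])
  show ?thesis
    using False connected_covering_limit_map equivalent_to_limit_map by auto
qed

end
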